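(* $p_c(n;K_{2,4})=\Theta\left(n^{-10/13}\right)$ as $n\to\infty$; that is, there are constants $c_1,c_2>0$ such that $c_1 n^{-10/13}\leqslant p_c(n;K_{2,4})\leqslant c_2 n^{-10/13}$ for all sufficiently large $n$.
   Context: All graphs are finite, undirected, without loops or multiple edges. $K_{s,t}$ is the complete bipartite graph with part sizes $s$ and $t$. $H$-bootstrap process: for graphs $G$ and $H$, let $G_0=G$ and, for $i=1,2,\ldots$, let $G_i$ be the graph with vertex set $V(G)$ and edge set $E(G_{i-1})\cup E_i$, where $E_i$ is the set of all edges $e$ of the complement of $G_{i-1}$ such that adding $e$ (alone) to $G_{i-1}$ creates a new copy of $H$ (as a not necessarily induced subgraph; a new copy is one containing $e$). Let $\widehat{G}_H$ be the graph with vertex set $V(G)$ and edge set $\bigcup_{i\geqslant 0}E(G_i)$. The graph $G$ percolates in the $H$-bootstrap process if $\widehat{G}_H$ is a complete graph. $\mathbb{G}(n,p)$ is the Erdős–Rényi random graph on a fixed vertex set of size $n$, in which every two distinct vertices are adjacent independently with probability $p$. Define $$p_c(n;H)=\inf\left\{p\in[0,1] : \mathbb{P}\big(\mathbb{G}(n,p)\text{ percolates in the }H\text{-bootstrap process}\big)\geqslant \tfrac12\right\}.$$ *)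

theory Defs
  imports "HOL-Probability.Probability" "HOL-Library.Ramsey" "HOL-Library.Landau_Symbols"
begin

text \<open>
  A simple graph is a pair of a vertex set and a set of edges, each edge being a two-element
  set of vertices. The set of all pairs of vertices from \<open>V\<close> is \<open>nsets V 2\<close>.
\<close>

type_synonym 'a graph = "'a set \<times> 'a set set"

abbreviation verts :: "'a graph \<Rightarrow> 'a set" where "verts \<equiv> fst"

abbreviation edges :: "'a graph \<Rightarrow> 'a set set" where "edges \<equiv> snd"

definition complete_graph :: "'a graph \<Rightarrow> bool" where
  "complete_graph G \<longleftrightarrow> edges G = nsets (verts G) 2"

definition complete_bipartite :: "nat \<Rightarrow> nat \<Rightarrow> (nat + nat) graph" where
  "complete_bipartite s t =
     ({..<s} <+> {..<t}, {{Inl i, Inr j} | i j. i < s \<and> j < t})"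

definition add_edge :: "'a graph \<Rightarrow> 'a set \<Rightarrow> 'a graph" where
  "add_edge G e = (verts G, insert e (edges G))"

text \<open>
  The copies of \<open>H\<close> in \<open>G\<close> are the (not necessarily induced) subgraphs of \<open>G\<close> that are images
  of \<open>H\<close> under an injective vertex map.
\<close>

definition copies :: "'b graph \<Rightarrow> 'a graph \<Rightarrow> 'a graph set" where
  "copies H G = {(f ` verts H, (\<lambda>e. f ` e) ` edges H) | f.
     inj_on f (verts H) \<and> f ` verts H \<subseteq> verts G \<and> (\<lambda>e. f ` e) ` edges H \<subseteq> edges G}"

definition new_edges :: "'b graph \<Rightarrow> 'a graph \<Rightarrow> 'a set set" where
  "new_edges H G =
     {e \<in> nsets (verts G) 2 - edges G. \<exists>C \<in> copies H (add_edge G e). e \<in> edges C}"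

primrec bootstrap :: "'b graph \<Rightarrow> 'a graph \<Rightarrow> nat \<Rightarrow> 'a graph" where
  "bootstrap H G 0 = G"
| "bootstrap H G (Suc i) =
     (verts G, edges (bootstrap H G i) \<union> new_edges H (bootstrap H G i))"

definition bootstrap_closure :: "'b graph \<Rightarrow> 'a graph \<Rightarrow> 'a graph" where
  "bootstrap_closure H G = (verts G, \<Union>i. edges (bootstrap H G i))"

definition percolates :: "'b graph \<Rightarrow> 'a graph \<Rightarrow> bool" where
  "percolates H G \<longleftrightarrow> complete_graph (bootstrap_closure H G)"

text \<open>
  The Erdos-Renyi random graph on the vertex set \<open>{..<n}\<close>: independent Bernoulli variables
  indexed by the pairs of vertices tell which pairs are edges. Only \<open>p \<in> {0..1}\<close> is meaningful.
\<close>

definition random_graph :: "nat \<Rightarrow> real \<Rightarrow> nat graph pmf" where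
  "random_graph n p =
     map_pmf (\<lambda>X. ({..<n}, {e \<in> nsets {..<n} 2. X e}))
       (Pi_pmf (nsets {..<n} 2) False (\<lambda>_. bernoulli_pmf p))"

definition critical_prob :: "nat \<Rightarrow> 'b graph \<Rightarrow> real" where
  "critical_prob n H =
     Inf {p \<in> {0..1}. measure_pmf.prob (random_graph n p) {G. percolates H G} \<ge> 1/2}"

end

theory Submission
  imports Defs "HOL-Real_Asymp.Real_Asymp"
begin

text \<open>
  In the process for \<open>K\<^sub>2\<^sub>,\<^sub>4\<close>, two vertices with three common neighbours become twins. Give a vertex
  set \<open>S\<close> the weight \<open>13 |S| - 10 e(S)\<close>, so that at \<open>p = n\<^sup>-\<^sup>1\<^sup>0\<^sup>/\<^sup>1\<^sup>3\<close> the expected number of copies of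
  \<open>S\<close> has order \<open>n\<close> to the power \<open>1/13\<close> of the weight.

  Below the threshold all small vertex sets have positive weight. Every pair of twins then comes from
  a cluster that starts as a \<open>K\<^sub>2\<^sub>,\<^sub>3\<close> (weight 5) and grows by ears attached to a twin pair, each of which
  costs weight 1 or 4; hence clusters stay bounded. Contracting the twin pairs turns a cluster into a
  tree, so a maximal family of disjoint clusters, blown up again, is closed under the process: two
  classes with three common neighbours would produce either a new or larger cluster, or a small set
  of nonpositive weight.

  Above the threshold the second moment method finds a strictly balanced seed with 10 vertices and
  13 edges. Its closure contains a pair of adjacent twin classes that absorb all their neighbours, and
  in a connected graph that is not bipartite these two classes are equal and cover everything.
\<close>

section \<open>Edge sets closed under the process\<close>

text \<open>The exponent marks the point where growth stops costing weight. The seed is a K_{2,3},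
  an ear of length 4, and then an ear of length 3 attached to the resulting cluster of weight 4:
  \<open>5 - 1 - 4 = 0\<close>, that is, 10 vertices and 13 edges. Positivity of the weight excludes
  precisely such a set.

  The obstacle to a lower bound is that positivity can be demanded only of sets of bounded size,
  while the process may run for long. Hence the process is not followed in time: a proper closed
  superset of the edges refutes percolation, and it is read off from a family of clusters that
  covers as many vertices as possible. A violation of closure involves at most five blocks with at
  most 17 vertices each, hence at most 85 vertices; the bound 100 in \<open>sparse_graph\<close>
  leaves room for this, and it keeps the first moment computation a union bound over sets of bounded
  size.\<close>

abbreviation (input) K24 :: "(nat + nat) graph" where
  "K24 \<equiv> complete_bipartite 2 4"

text \<open>The K_{2,4} in question has the sides \<open>{x, y}\<close> and
  \<open>insert v Z\<close>; its seven edges other than \<open>{x, v}\<close> force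
  \<open>{x, v}\<close>. Stated for bare edge sets, the rule can be checked for a set that is not a
  stage of the process.\<close>

definition twin_closed :: "'a set set \<Rightarrow> bool" where
  "twin_closed H \<longleftrightarrow> (\<forall>x y v Z. x \<noteq> y \<and> v \<noteq> x \<and> card Z = 3 \<and>
     (\<forall>z\<in>Z. {x, z} \<in> H \<and> {y, z} \<in> H) \<and> {y, v} \<in> H \<longrightarrow> {x, v} \<in> H)"

lemma twin_closedD:
  assumes "twin_closed H" "x \<noteq> y" "v \<noteq> x" "card Z = 3"
    "\<And>z. z \<in> Z \<Longrightarrow> {x, z} \<in> H" "\<And>z. z \<in> Z \<Longrightarrow> {y, z} \<in> H" "{y, v} \<in> H"
  shows "{x, v} \<in> H"
  using assms unfolding twin_closed_def by blast

lemma verts_bootstrap [simp]: "verts (bootstrap H G i) = verts G"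
  by (induction i) auto

lemma new_edges_in_twin_closed:
  assumes H: "twin_closed H" and sub: "edges G \<subseteq> H" and e: "e \<in> new_edges K24 G"
  shows "e \<in> H"
proof -
  from e obtain C where eG: "e \<notin> edges G" and C: "C \<in> copies K24 (add_edge G e)" "e \<in> edges C"
    by (auto simp: new_edges_def)
  from C obtain f where inj: "inj_on f ({..<2} <+> {..<4})"
    and fE: "(\<lambda>e. f ` e) ` {{Inl i, Inr j} | i j. i < (2::nat) \<and> j < (4::nat)} \<subseteq> insert e (edges G)"
    and ef: "e \<in> (\<lambda>e. f ` e) ` {{Inl i, Inr j} | i j. i < (2::nat) \<and> j < (4::nat)}"
    unfolding copies_def complete_bipartite_def add_edge_def by auto
  from ef obtain i j where ij: "i < 2" "j < 4" and e_eq: "e = {f (Inl i), f (Inr j)}"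
    by auto
  have edge: "{f (Inl i'), f (Inr j')} \<in> insert e (edges G)" if "i' < 2" "j' < 4" for i' j'
  proof -
    have "f ` {Inl i', Inr j'} \<in> insert e (edges G)"
      using that by (intro subsetD[OF fE] imageI) blast
    then show ?thesis by simp
  qed
  have f_eq: "f (Inl a) = f (Inl b) \<longleftrightarrow> a = b" if "a < 2" "b < 2" for a b
    using inj_on_eq_iff[OF inj, of "Inl a" "Inl b"] that by auto
  have f_eq': "f (Inr a) = f (Inr b) \<longleftrightarrow> a = b" if "a < 4" "b < 4" for a b
    using inj_on_eq_iff[OF inj, of "Inr a" "Inr b"] that by auto
  have f_neq: "f (Inl a) \<noteq> f (Inr b)" "f (Inr b) \<noteq> f (Inl a)" if "a < 2" "b < 4" for a b
    using inj_on_eq_iff[OF inj, of "Inl a" "Inr b"] inj_on_eq_iff[OF inj, of "Inr b" "Inl a"] that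
    by (auto simp: InlI InrI)
  \<comment> \<open>The small side has the indices 0 and 1, so \<open>1 - i\<close> is the partner
    of \<open>i\<close>.\<close>
  define k where "k = 1 - i"
  have k: "k < 2" "k \<noteq> i" using ij unfolding k_def by arith+
  let ?Z = "(f \<circ> Inr) ` ({..<4} - {j})"
  have "card ?Z = card ({..<4} - {j})"
  proof (intro card_image inj_onI)
    fix a b assume ab: "a \<in> {..<4} - {j}" "b \<in> {..<4} - {j}" "(f \<circ> Inr) a = (f \<circ> Inr) b"
    then have "f (Inr a) = f (Inr b)" by simp
    with ab show "a = b" using f_eq' by auto
  qed
  also have "\<dots> = 3" using ij by simp
  finally have cZ: "card ?Z = 3" .
  have "{f (Inl i), f (Inr j)} \<in> H"
  proof (rule twin_closedD[OF H, of "f (Inl i)" "f (Inl k)" _ ?Z])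
    show "f (Inl i) \<noteq> f (Inl k)" "f (Inr j) \<noteq> f (Inl i)"
      using ij k by (simp_all add: f_eq f_neq)
    show "card ?Z = 3" by (rule cZ)
    show "{f (Inl k), f (Inr j)} \<in> H"
      using edge[OF k(1) ij(2)] sub ij k by (auto simp: e_eq doubleton_eq_iff f_eq f_eq' f_neq)
  next
    fix z assume "z \<in> ?Z"
    then obtain j' where j': "j' < 4" "j' \<noteq> j" "z = f (Inr j')" by auto
    show "{f (Inl i), z} \<in> H"
      using edge[OF ij(1) j'(1)] sub ij j' by (auto simp: e_eq doubleton_eq_iff f_eq f_eq' f_neq)
    show "{f (Inl k), z} \<in> H"
      using edge[OF k(1) j'(1)] sub ij j' k by (auto simp: e_eq doubleton_eq_iff f_eq f_eq' f_neq)
  qed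
  then show ?thesis by (simp add: e_eq)
qed

lemma bootstrap_closure_least:
  assumes "twin_closed H" "edges G \<subseteq> H"
  shows "edges (bootstrap_closure K24 G) \<subseteq> H"
proof -
  have "edges (bootstrap K24 G i) \<subseteq> H" for i
    by (induction i) (use assms(2) in \<open>simp_all add: new_edges_in_twin_closed[OF assms(1)] subset_iff\<close>)
  then show ?thesis by (auto simp: bootstrap_closure_def)
qed

lemma edges_bootstrap_mono: "i \<le> j \<Longrightarrow> edges (bootstrap H G i) \<subseteq> edges (bootstrap H G j)"
  by (induction j rule: dec_induct) auto

lemma edges_bootstrap_wf:
  assumes "edges G \<subseteq> nsets (verts G) 2"
  shows "edges (bootstrap H G i) \<subseteq> nsets (verts G) 2"
  by (induction i) (use assms in \<open>auto simp: new_edges_def\<close>)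

lemma edges_closure_wf:
  assumes "edges G \<subseteq> nsets (verts G) 2"
  shows "edges (bootstrap_closure H G) \<subseteq> nsets (verts G) 2"
  unfolding bootstrap_closure_def snd_conv using edges_bootstrap_wf[OF assms] by (rule UN_least)

lemma edges_subset_closure: "edges G \<subseteq> edges (bootstrap_closure H G)"
proof -
  have "edges G = edges (bootstrap H G 0)" by simp
  then show ?thesis unfolding bootstrap_closure_def snd_conv by blast
qed

text \<open>The stages increase, so finitely many edges of the limit already occur together at one
  stage. This is applied to the at most seven edges in a premise of the twin rule.\<close>

lemma finite_edges_closure_stage:
  assumes "finite D" "D \<subseteq> edges (bootstrap_closure H G)"
  shows "\<exists>i. D \<subseteq> edges (bootstrap H G i)"
  using assms
proof (induction rule: finite_induct)
  case (insert e D)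
  then obtain i where i: "D \<subseteq> edges (bootstrap H G i)" by auto
  from insert obtain j where j: "e \<in> edges (bootstrap H G j)" by (auto simp: bootstrap_closure_def)
  have "insert e D \<subseteq> edges (bootstrap H G (max i j))"
    using i j edges_bootstrap_mono[of i "max i j" H G] edges_bootstrap_mono[of j "max i j" H G]
    by auto
  then show ?case by blast
qed auto

lemma new_edgesI:
  assumes wf: "edges G \<subseteq> nsets (verts G) 2" and "x \<noteq> y" "v \<noteq> x" "card Z = 3"
    and Z: "\<And>z. z \<in> Z \<Longrightarrow> {x, z} \<in> edges G" "\<And>z. z \<in> Z \<Longrightarrow> {y, z} \<in> edges G"
    and yv: "{y, v} \<in> edges G" and xv: "{x, v} \<notin> edges G"
  shows "{x, v} \<in> new_edges K24 G"
proof -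
  obtain z where z: "bij_betw z {..<3::nat} Z"
    using \<open>card Z = 3\<close> finite_same_card_bij[of "{..<3::nat}" Z] card.infinite by fastforce
  define f where "f = case_sum (\<lambda>i::nat. if i = 0 then x else y) (\<lambda>j. if j < 3 then z j else v)"
  have E: "a \<in> verts G \<and> b \<in> verts G \<and> a \<noteq> b" if "{a, b} \<in> edges G" for a b
    using subsetD[OF wf that] by (simp add: doubleton_in_nsets_2)
  have vZ: "v \<notin> Z" using Z(1) xv by auto
  have nZ: "x \<notin> Z" "y \<notin> Z" using E[OF Z(1)] E[OF Z(2)] by auto
  have z_in: "z j \<in> Z" if "j < 3" for j using z that by (auto simp: bij_betw_def)
  have z_inj: "z i = z j \<longleftrightarrow> i = j" if "i < 3" "j < 3" for i j
    using z that by (auto simp: bij_betw_def inj_on_def)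
  have "z 0 \<in> Z" using z_in by simp
  then have verts: "x \<in> verts G" "y \<in> verts G" "v \<in> verts G" "Z \<subseteq> verts G" "y \<noteq> v"
    using E[OF Z(1)] E[OF yv] by auto
  have fl: "f (Inl i) = (if i = 0 then x else y)" and fr: "f (Inr j) = (if j < 3 then z j else v)" for i j
    by (simp_all add: f_def)
  have frv: "f (Inr j) \<in> insert v Z" for j
    using z_in by (simp add: fr)
  have inj: "inj_on f ({..<2} <+> {..<4})"
  proof (rule inj_onI)
    fix a b assume ab: "a \<in> {..<2} <+> {..<4}" "b \<in> {..<2} <+> {..<4}" "f a = f b"
    have lr: "f (Inl i) \<noteq> f (Inr j)" for i j
      using frv[of j] nZ \<open>v \<noteq> x\<close> \<open>y \<noteq> v\<close> by (auto simp: fl)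
    have ll: "i = j" if "i < 2" "j < 2" "f (Inl i) = f (Inl j)" for i j
      using that \<open>x \<noteq> y\<close> unfolding fl by (auto split: if_splits)
    have rr: "i = j" if ij: "i < 4" "j < 4" "f (Inr i) = f (Inr j)" for i j
    proof -
      consider "i < 3" "j < 3" | "i < 3" "j = 3" | "i = 3" "j < 3" | "i = 3" "j = 3"
        using ij(1,2) by linarith
      then show ?thesis using ij(3) z_inj[of i j] z_in vZ unfolding fr by cases auto
    qed
    from ab show "a = b"
      using lr lr[symmetric] ll rr by (cases a; cases b) auto
  qed
  have im: "f ` ({..<2} <+> {..<4}) \<subseteq> verts G"
  proof
    fix t assume "t \<in> f ` ({..<2} <+> {..<4})"
    then obtain a where t: "t = f a" by blast
    show "t \<in> verts G"
    proof (cases a)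
      case (Inr j)
      then show ?thesis using t frv[of j] verts by auto
    qed (use t verts in \<open>simp add: fl\<close>)
  qed
  have ed1: "{f (Inl i), f (Inr j)} \<in> insert {x, v} (edges G)" for i j
    using Z z_in yv by (cases "i = 0"; cases "j < 3") (simp_all add: fl fr)
  let ?B = "{{Inl i, Inr j} | i j. i < (2::nat) \<and> j < (4::nat)}"
  have ed: "(\<lambda>e. f ` e) ` ?B \<subseteq> insert {x, v} (edges G)"
    using ed1 by (force simp del: insert_iff)
  have "f ` {Inl 0, Inr 3} = {x, v}" by (simp add: fl fr)
  moreover have "{Inl 0, Inr 3} \<in> ?B" by (rule CollectI, intro exI[of _ 0] exI[of _ 3]) simp
  ultimately have xvB: "{x, v} \<in> (\<lambda>e. f ` e) ` ?B" by (metis (no_types, lifting) image_eqI)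
  have "(f ` ({..<2} <+> {..<4}), (\<lambda>e. f ` e) ` ?B) \<in> copies K24 (add_edge G {x, v})"
    using inj im ed unfolding copies_def complete_bipartite_def add_edge_def fst_conv snd_conv
    by blast
  then have "\<exists>C\<in>copies K24 (add_edge G {x, v}). {x, v} \<in> edges C"
    by (rule bexI[rotated]) (use xvB in \<open>simp only: snd_conv\<close>)
  then show ?thesis
    using verts xv \<open>v \<noteq> x\<close> by (auto simp: new_edges_def doubleton_in_nsets_2)
qed

lemma twin_closed_bootstrap_closure:
  assumes wf: "edges G \<subseteq> nsets (verts G) 2"
  shows "twin_closed (edges (bootstrap_closure K24 G))"
  unfolding twin_closed_def
proof (intro allI impI, elim conjE)
  fix x y v Z
  assume xy: "x \<noteq> y" "v \<noteq> x" and cZ: "card Z = 3"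
    and Z: "\<forall>z\<in>Z. {x, z} \<in> edges (bootstrap_closure K24 G) \<and> {y, z} \<in> edges (bootstrap_closure K24 G)"
    and yv: "{y, v} \<in> edges (bootstrap_closure K24 G)"
  let ?D = "insert {y, v} ((\<lambda>z. {x, z}) ` Z \<union> (\<lambda>z. {y, z}) ` Z)"
  have "finite ?D" using cZ card.infinite by fastforce
  then obtain i where i: "?D \<subseteq> edges (bootstrap K24 G i)"
    using finite_edges_closure_stage[of ?D K24 G] Z yv by blast
  have "{x, v} \<in> edges (bootstrap K24 G (Suc i))"
  proof (cases "{x, v} \<in> edges (bootstrap K24 G i)")
    case False
    then have "{x, v} \<in> new_edges K24 (bootstrap K24 G i)"
      using i by (intro new_edgesI[OF _ xy cZ]) (simp_all add: edges_bootstrap_wf[OF wf] image_subset_iff)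
    then show ?thesis by simp
  qed simp
  then show "{x, v} \<in> edges (bootstrap_closure K24 G)"
    unfolding bootstrap_closure_def snd_conv by blast
qed

section \<open>Clusters in locally sparse graphs\<close>

definition weight :: "'a set set \<Rightarrow> 'a set \<Rightarrow> int" where
  "weight E S = 13 * int (card S) - 10 * int (card (E \<inter> Pow S))"

section \<open>Quotient relations, 4-cycles, and weights of disjoint unions\<close>

definition edge_rel :: "('a \<Rightarrow> 'b) \<Rightarrow> 'a set set \<Rightarrow> ('b \<times> 'b) set" where
  "edge_rel c D = {(c a, c b) | a b. {a, b} \<in> D}"

definition C4_free :: "('b \<times> 'b) set \<Rightarrow> bool" where
  "C4_free R \<longleftrightarrow> (\<forall>p q r s. (p, r) \<in> R \<and> (p, s) \<in> R \<and> (q, r) \<in> R \<and> (q, s) \<in> R \<longrightarrow> p = q \<or> r = s)"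

lemma edge_rel_empty [simp]: "edge_rel c {} = {}"
  by (simp add: edge_rel_def)

lemma edge_rel_insert [simp]:
  "edge_rel c (insert {a, b} D) = {(c a, c b), (c b, c a)} \<union> edge_rel c D"
  by (auto simp: edge_rel_def doubleton_eq_iff)

lemma edge_rel_Un [simp]: "edge_rel c (D \<union> D') = edge_rel c D \<union> edge_rel c D'"
  by (auto simp: edge_rel_def)

lemma edge_rel_cong:
  assumes "D \<subseteq> Pow S" "\<And>x. x \<in> S \<Longrightarrow> c x = c' x"
  shows "edge_rel c D = edge_rel c' D"
proof -
  have "c a = c' a \<and> c b = c' b" if "{a, b} \<in> D" for a b
    using that assms by auto
  then show ?thesis unfolding edge_rel_def by metis
qed

lemma edge_relI: "{a, b} \<in> D \<Longrightarrow> (c a, c b) \<in> edge_rel c D"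
  by (auto simp: edge_rel_def)

lemma edge_rel_sub: "D \<subseteq> Pow S \<Longrightarrow> edge_rel c D \<subseteq> c ` S \<times> c ` S"
  by (auto simp: edge_rel_def)

lemma C4_freeD:
  "C4_free R \<Longrightarrow> (p, r) \<in> R \<Longrightarrow> (p, s) \<in> R \<Longrightarrow> (q, r) \<in> R \<Longrightarrow> (q, s) \<in> R \<Longrightarrow> p = q \<or> r = s"
  unfolding C4_free_def by blast

lemma C4_free_empty: "C4_free {}"
  by (simp add: C4_free_def)

text \<open>A pendant vertex lies on no 4-cycle: if \<open>z\<close> is one of the four corners,
  both of its neighbours on the cycle are \<open>a\<close>.\<close>

lemma C4_free_leaf:
  assumes "C4_free R" "R \<subseteq> L \<times> L" "z \<notin> L" "a \<noteq> z"
  shows "C4_free ({(a, z), (z, a)} \<union> R)"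
  unfolding C4_free_def
proof (intro allI impI, elim conjE)
  fix p q r s
  assume *: "(p, r) \<in> {(a, z), (z, a)} \<union> R" "(p, s) \<in> {(a, z), (z, a)} \<union> R"
    "(q, r) \<in> {(a, z), (z, a)} \<union> R" "(q, s) \<in> {(a, z), (z, a)} \<union> R"
  have nz: "(z, t) \<notin> R" "(t, z) \<notin> R" for t using assms by auto
  show "p = q \<or> r = s"
  proof (cases "z \<in> {p, q, r, s}")
    case True
    then show ?thesis using * nz assms(4) by auto
  next
    case False
    then show ?thesis using * C4_freeD[OF assms(1), of p r s q] by auto
  qed
qed

text \<open>Vertices and inner edges add up over disjoint blocks, and every crossing edge in
  \<open>D\<close> takes off a further 10. Further crossing edges may exist, whence only an
  inequality.\<close>

lemma weight_Union:
  assumes E: "finite E" "{} \<notin> E" and B: "finite B" "\<And>S. S \<in> B \<Longrightarrow> finite S" "pairwise disjnt B"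
    and D: "D \<subseteq> E" "\<And>d. d \<in> D \<Longrightarrow> d \<subseteq> \<Union>B" "\<And>d S. d \<in> D \<Longrightarrow> S \<in> B \<Longrightarrow> \<not> d \<subseteq> S"
  shows "weight E (\<Union>B) \<le> (\<Sum>S\<in>B. weight E S) - 10 * int (card D)"
proof -
  have disj: "S \<inter> T = {}" if "S \<in> B" "T \<in> B" "S \<noteq> T" for S T
    using B(3) that by (auto simp: pairwise_def disjnt_def)
  have 1: "card (\<Union>B) = (\<Sum>S\<in>B. card S)"
    using B by (intro card_Union_disjoint) (auto simp: pairwise_def disjnt_def)
  have "card D + (\<Sum>S\<in>B. card (E \<inter> Pow S)) = card D + card (\<Union>S\<in>B. E \<inter> Pow S)"
  proof -
    \<comment> \<open>The empty set belongs to every \<open>Pow S\<close>;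
      \<open>{} \<notin> E\<close> is what makes the inner edge sets of different blocks
      disjoint.\<close>
    have "(E \<inter> Pow S) \<inter> (E \<inter> Pow T) = {}" if "S \<inter> T = {}" for S T
    proof -
      have "e = {}" if "e \<subseteq> S" "e \<subseteq> T" for e using that \<open>S \<inter> T = {}\<close> by blast
      then show ?thesis using E(2) by blast
    qed
    then show ?thesis using B(1) E(1) disj by (subst card_UN_disjoint) auto
  qed
  also have "\<dots> = card (D \<union> (\<Union>S\<in>B. E \<inter> Pow S))"
    using D E finite_subset[OF D(1) E(1)] B(1) by (intro card_Un_disjoint[symmetric]) auto
  also have "\<dots> \<le> card (E \<inter> Pow (\<Union>B))"
    using D E by (intro card_mono) auto
  finally have 2: "card D + (\<Sum>S\<in>B. card (E \<inter> Pow S)) \<le> card (E \<inter> Pow (\<Union>B))" .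
  have "(\<Sum>S\<in>B. weight E S) = 13 * int (\<Sum>S\<in>B. card S) - 10 * int (\<Sum>S\<in>B. card (E \<inter> Pow S))"
    unfolding weight_def by (simp add: sum_subtractf sum_distrib_left)
  then show ?thesis using 1 2 unfolding weight_def by linarith
qed

section \<open>Clusters and blocks in a locally sparse graph\<close>

locale sparse_graph =
  fixes V :: "'a set" and E :: "'a set set"
  assumes finite_V: "finite V" and E_sub: "E \<subseteq> nsets V 2"
    and sparse: "\<And>S. S \<subseteq> V \<Longrightarrow> S \<noteq> {} \<Longrightarrow> card S \<le> 100 \<Longrightarrow> weight E S > 0"
begin

text \<open>
  The map \<open>c\<close> labels the twin classes, so \<open>card S - card (c ` S)\<close> is the number of twin pairs in \<open>S\<close>.
  The numerical conditions bound the size and the number of twin pairs by the weight that has been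
  spent; acyclicity of the quotient is only needed in the form that it has no loops and no 4-cycles.
\<close>

definition cluster :: "('a \<Rightarrow> 'a) \<Rightarrow> 'a set \<Rightarrow> bool" where
  "cluster c S \<longleftrightarrow> S \<subseteq> V \<and> weight E S \<ge> 1 \<and> int (card S) + 3 * weight E S \<le> 20 \<and>
     weight E S + int (card S) \<le> 6 + int (card (c ` S)) \<and> card (c ` S) < card S \<and>
     C4_free (edge_rel c (E \<inter> Pow S)) \<and> irrefl (edge_rel c (E \<inter> Pow S)) \<and>
     (\<forall>x\<in>S. card {y \<in> S. c y = c x} \<le> 2)"

text \<open>One global labelling serves all clusters, so that an enlargement only has to relabel one
  new vertex. Two different vertices of \<open>V\<close> can share a label only inside a common
  cluster.\<close>

definition clustering :: "('a \<Rightarrow> 'a) \<Rightarrow> 'a set set \<Rightarrow> bool" where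
  "clustering c F \<longleftrightarrow> pairwise disjnt F \<and> (\<forall>S\<in>F. cluster c S) \<and>
     (\<forall>S\<in>F. \<forall>x\<in>S. \<forall>y\<in>V. c x = c y \<longrightarrow> y \<in> S) \<and>
     (\<forall>x\<in>V - \<Union>F. \<forall>y\<in>V. c x = c y \<longrightarrow> x = y)"

text \<open>Adjacency of classes in the quotient graph. The closed supergraph will be the blow-up of
  this relation.\<close>

definition qadj :: "('a \<Rightarrow> 'a) \<Rightarrow> 'a \<Rightarrow> 'a \<Rightarrow> bool" where
  "qadj c x y \<longleftrightarrow> (\<exists>a b. {a, b} \<in> E \<and> c a = c x \<and> c b = c y)"

text \<open>Uncovered vertices count as one-element blocks. All of \<open>V\<close> is then
  partitioned into pieces of weight at most 5 (clusters) or exactly 13 (single vertices), which the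
  weight estimates can treat alike.\<close>

definition block :: "'a set set \<Rightarrow> 'a \<Rightarrow> 'a set" where
  "block F x = {y. y = x \<or> (\<exists>S\<in>F. x \<in> S \<and> y \<in> S)}"

lemma finite_E: "finite E"
  using E_sub finite_V finite_imp_finite_nsets finite_subset by blast

lemma edge_pair: "{a, b} \<in> E \<Longrightarrow> a \<in> V \<and> b \<in> V \<and> a \<noteq> b"
  using subsetD[OF E_sub, of "{a, b}"] by (simp add: doubleton_in_nsets_2)

lemma empty_notin_E: "{} \<notin> E"
  using E_sub by (auto simp: nsets_def)

lemma singleton_notin_E: "{a} \<notin> E"
  using edge_pair[of a a] by auto

lemma weight_singleton: "weight E {x} = 13"
proof -
  have "E \<inter> Pow {x} = {}"
    using empty_notin_E singleton_notin_E by (auto simp: subset_singleton_iff Pow_insert)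
  then show ?thesis by (simp add: weight_def)
qed

lemma qadj_sym: "qadj c x y \<Longrightarrow> qadj c y x"
  unfolding qadj_def by (metis insert_commute)

text \<open>One edge beyond \<open>D\<close> would cost another 10 and make the weight nonpositive,
  against sparsity. So the listed edges are all the new ones, and the quotient of the enlarged set
  is known exactly.\<close>

lemma exact_extension:
  assumes "S \<subseteq> V" "X \<subseteq> V" "S \<inter> X = {}" "X \<noteq> {}" "card S + card X \<le> 100"
    and D: "D \<subseteq> E" "D \<subseteq> Pow (S \<union> X)" "\<And>d. d \<in> D \<Longrightarrow> \<not> d \<subseteq> S"
    and le: "weight E S + 13 * int (card X) - 10 * int (card D) \<le> 10"
  shows "E \<inter> Pow (S \<union> X) = E \<inter> Pow S \<union> D"
    and "weight E (S \<union> X) = weight E S + 13 * int (card X) - 10 * int (card D)"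
    and "weight E (S \<union> X) \<ge> 1"
proof -
  have fin: "finite S" "finite X" "finite D"
    using assms finite_V finite_E finite_subset by blast+
  define N where "N = E \<inter> Pow (S \<union> X) - Pow S"
  have eq: "E \<inter> Pow (S \<union> X) = E \<inter> Pow S \<union> N" by (auto simp: N_def)
  have fN: "finite N" using finite_E by (simp add: N_def)
  have "card (E \<inter> Pow (S \<union> X)) = card (E \<inter> Pow S) + card N"
    unfolding eq using finite_E fN by (intro card_Un_disjoint) (auto simp: N_def)
  moreover have "card (S \<union> X) = card S + card X"
    using fin assms(3) by (intro card_Un_disjoint) auto
  ultimately have w: "weight E (S \<union> X) = weight E S + 13 * int (card X) - 10 * int (card N)"
    by (simp add: weight_def)
  show pos: "weight E (S \<union> X) \<ge> 1"
    using sparse[of "S \<union> X"] assms \<open>card (S \<union> X) = _\<close> by auto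
  have "D \<subseteq> N" using D by (auto simp: N_def)
  moreover have "card N \<le> card D" using w pos le by linarith
  ultimately have "D = N" using fN card_seteq by metis
  then show "E \<inter> Pow (S \<union> X) = E \<inter> Pow S \<union> D"
    "weight E (S \<union> X) = weight E S + 13 * int (card X) - 10 * int (card D)"
    using eq w by auto
qed

text \<open>A cluster has at least one twin pair, and weight plus number of pairs is at most 6, so
  the weight is at most 5. Weight at least 1 leaves at most \<open>20 - 3\<close> vertices.\<close>

lemma clusterD:
  assumes "cluster c S"
  shows "S \<subseteq> V" "1 \<le> weight E S" "weight E S \<le> 5" "card S \<le> 17" "finite S" "S \<noteq> {}"
  using assms finite_subset[OF _ finite_V] unfolding cluster_def by force+

end

section \<open>Weight estimates for a fixed clustering\<close>

locale clustered_graph = sparse_graph +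
  fixes c :: "'a \<Rightarrow> 'a" and F :: "'a set set"
  assumes clustering: "clustering c F"
begin

lemma F_cluster: "S \<in> F \<Longrightarrow> cluster c S"
  using clustering by (simp add: clustering_def)

lemma F_disjoint: "S \<in> F \<Longrightarrow> T \<in> F \<Longrightarrow> x \<in> S \<Longrightarrow> x \<in> T \<Longrightarrow> S = T"
  using clustering unfolding clustering_def pairwise_def disjnt_def by blast

lemma F_saturated: "S \<in> F \<Longrightarrow> x \<in> S \<Longrightarrow> y \<in> V \<Longrightarrow> c x = c y \<Longrightarrow> y \<in> S"
  using clustering unfolding clustering_def by blast

lemma outside_inj: "x \<in> V \<Longrightarrow> x \<notin> \<Union>F \<Longrightarrow> y \<in> V \<Longrightarrow> c x = c y \<Longrightarrow> x = y"
  using clustering unfolding clustering_def by blast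

lemma Union_F_sub: "\<Union>F \<subseteq> V"
  using F_cluster clusterD(1) by blast

lemma block_F: "S \<in> F \<Longrightarrow> x \<in> S \<Longrightarrow> block F x = S"
  unfolding block_def using F_disjoint by blast

lemma block_outside: "x \<notin> \<Union>F \<Longrightarrow> block F x = {x}"
  unfolding block_def by blast

lemma block_self: "x \<in> block F x"
  by (simp add: block_def)

lemma block_eqI: "y \<in> block F x \<Longrightarrow> block F y = block F x"
  by (cases "x \<in> \<Union>F") (auto simp: block_F block_outside)

lemma block_in_F: "x \<in> \<Union>F \<Longrightarrow> block F x \<in> F"
  by (auto simp: block_F)

lemma block_cases:
  obtains "x \<in> \<Union>F" "block F x \<in> F" "1 \<le> weight E (block F x)" "weight E (block F x) \<le> 5"
  | "x \<notin> \<Union>F" "block F x = {x}" "weight E (block F x) = 13"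
  using block_in_F[of x] clusterD(2,3)[OF F_cluster] block_outside[of x] weight_singleton
  by (cases "x \<in> \<Union>F") auto

lemma block_sub: "x \<in> V \<Longrightarrow> block F x \<subseteq> V"
  using clusterD(1)[OF F_cluster] by (cases x rule: block_cases) auto

lemma card_block: "card (block F x) \<le> 17"
  using clusterD(4)[OF F_cluster] by (cases x rule: block_cases) auto

lemma block_class: "x \<in> V \<Longrightarrow> y \<in> V \<Longrightarrow> c x = c y \<Longrightarrow> block F x = block F y"
  by (metis F_saturated block_F block_in_F block_self outside_inj)

lemma edge_class_neq:
  assumes "{a, b} \<in> E"
  shows "c a \<noteq> c b"
proof
  assume eq: "c a = c b"
  have ab: "a \<in> V" "b \<in> V" "a \<noteq> b" using edge_pair[OF assms] by auto
  with eq outside_inj have "a \<in> \<Union>F" by blast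
  then obtain S where S: "S \<in> F" "a \<in> S" by blast
  with ab eq F_saturated have "b \<in> S" by blast
  then have "(c a, c b) \<in> edge_rel c (E \<inter> Pow S)"
    using assms S by (intro edge_relI) auto
  then show False using F_cluster[OF S(1)] eq by (auto simp: cluster_def irrefl_def)
qed

lemma qadj_neq: "qadj c x y \<Longrightarrow> c x \<noteq> c y"
  unfolding qadj_def using edge_class_neq by metis

lemma qadj_edge_rel:
  assumes "qadj c x y" "S \<in> F" "x \<in> S" "y \<in> S"
  shows "(c x, c y) \<in> edge_rel c (E \<inter> Pow S)"
proof -
  obtain a b where ab: "{a, b} \<in> E" "c a = c x" "c b = c y"
    using assms(1) unfolding qadj_def by blast
  then have "a \<in> S" "b \<in> S"
    using edge_pair[OF ab(1)] F_saturated[OF assms(2,3)] F_saturated[OF assms(2,4)] by auto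
  then have "{a, b} \<in> E \<inter> Pow S" using ab by simp
  from edge_relI[OF this, of c] show ?thesis using ab by simp
qed

lemma no_C4_in_cluster:
  assumes "S \<in> F" "{x, y, z, z'} \<subseteq> S" "qadj c x z" "qadj c x z'" "qadj c y z" "qadj c y z'"
  shows "c x = c y \<or> c z = c z'"
proof -
  have "C4_free (edge_rel c (E \<inter> Pow S))"
    using F_cluster[OF assms(1)] by (simp add: cluster_def)
  then show ?thesis
    using assms by (intro C4_freeD[of "edge_rel c (E \<inter> Pow S)"] qadj_edge_rel) auto
qed

text \<open>
  The union of the blocks of \<open>x\<close>, \<open>y\<close> and \<open>Z\<close> has positive weight. It is bounded by summing over the
  blocks and subtracting 10 for each quotient edge that joins two different blocks.
\<close>

lemma join_weight:
  assumes xy: "x \<in> V" "y \<in> V" "c x \<noteq> c y" and Z: "Z \<subseteq> V" "inj_on c Z" "finite Z" "card Z \<le> 3"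
    and adj: "\<And>z. z \<in> Z \<Longrightarrow> qadj c x z" "\<And>z. z \<in> Z \<Longrightarrow> qadj c y z"
  defines "bx \<equiv> block F x" and "by \<equiv> block F y"
  shows "0 < (if bx = by then weight E bx else weight E bx + weight E by) +
    (\<Sum>z\<in>Z. (if block F z \<in> {bx, by} then 0 else weight E (block F z))
       - (if block F z = bx then 0 else 10) - (if block F z = by then 0 else 10))"
proof -
  let ?b = "block F"
  \<comment> \<open>In the set \<open>B\<close> coinciding blocks are counted once, whereas the sum
    over \<open>Z\<close> in the claim may repeat a block. This is harmless because block weights
    are nonnegative.\<close>
  define B where "B = {bx, by} \<union> ?b ` Z"
  define U where "U = \<Union>B"
  have "\<forall>z\<in>Z. \<exists>e. e \<in> E \<and> (\<exists>a b. e = {a, b} \<and> c a = c x \<and> c b = c z)"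
    using adj(1) unfolding qadj_def by metis
  then obtain ex where ex: "\<And>z. z \<in> Z \<Longrightarrow> ex z \<in> E \<and> (\<exists>a b. ex z = {a, b} \<and> c a = c x \<and> c b = c z)"
    unfolding bchoice_iff by blast
  have "\<forall>z\<in>Z. \<exists>e. e \<in> E \<and> (\<exists>a b. e = {a, b} \<and> c a = c y \<and> c b = c z)"
    using adj(2) unfolding qadj_def by metis
  then obtain ey where ey: "\<And>z. z \<in> Z \<Longrightarrow> ey z \<in> E \<and> (\<exists>a b. ey z = {a, b} \<and> c a = c y \<and> c b = c z)"
    unfolding bchoice_iff by blast
  \<comment> \<open>The chosen edges may end in twins of \<open>x\<close>, \<open>y\<close> or
    \<open>z\<close>. Their images under \<open>c\<close> are nevertheless determined, and these
    images tell the edges apart.\<close>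
  have imx: "c ` ex z = {c x, c z}" and imy: "c ` ey z = {c y, c z}" if "z \<in> Z" for z
    using ex[OF that] ey[OF that] by auto
  have neq: "c x \<noteq> c z" "c y \<noteq> c z" if "z \<in> Z" for z
    using adj[OF that] qadj_neq by auto
  have injx: "inj_on ex Z" and injy: "inj_on ey Z"
  proof -
    show "inj_on ex Z"
    proof (rule inj_onI)
      fix z z' assume *: "z \<in> Z" "z' \<in> Z" "ex z = ex z'"
      then have "{c x, c z} = {c x, c z'}" using imx by metis
      then have "c z = c z'" using neq * by (auto simp: doubleton_eq_iff)
      then show "z = z'" using Z(2) * by (auto simp: inj_on_def)
    qed
    show "inj_on ey Z"
    proof (rule inj_onI)
      fix z z' assume *: "z \<in> Z" "z' \<in> Z" "ey z = ey z'"
      then have "{c y, c z} = {c y, c z'}" using imy by metis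
      then have "c z = c z'" using neq * by (auto simp: doubleton_eq_iff)
      then show "z = z'" using Z(2) * by (auto simp: inj_on_def)
    qed
  qed
  have exy: "ex z \<noteq> ey z'" if "z \<in> Z" "z' \<in> Z" for z z'
  proof
    assume "ex z = ey z'"
    then have "{c x, c z} = {c y, c z'}" using imx imy that by metis
    then show False using neq[OF that(1)] neq[OF that(2)] xy by (auto simp: doubleton_eq_iff)
  qed
  \<comment> \<open>An edge inside a block is already part of the weight of that block; only edges
    between different blocks may be charged.\<close>
  define D1 where "D1 = ex ` {z \<in> Z. ?b z \<noteq> bx}"
  define D2 where "D2 = ey ` {z \<in> Z. ?b z \<noteq> by}"
  have "card (D1 \<union> D2) = card D1 + card D2"
    using Z(3) exy by (intro card_Un_disjoint) (auto simp: D1_def D2_def)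
  also have "card D1 = card {z \<in> Z. ?b z \<noteq> bx}"
    unfolding D1_def by (intro card_image inj_on_subset[OF injx]) auto
  also have "card D2 = card {z \<in> Z. ?b z \<noteq> by}"
    unfolding D2_def by (intro card_image inj_on_subset[OF injy]) auto
  finally have cD: "card (D1 \<union> D2) = card {z \<in> Z. ?b z \<noteq> bx} + card {z \<in> Z. ?b z \<noteq> by}" .
  have Bblock: "\<exists>v\<in>V. S = ?b v" if "S \<in> B" for S
    using that xy Z(1) by (auto simp: B_def bx_def by_def)
  have finB: "finite B" using Z(3) by (simp add: B_def)
  have Bfin: "finite S" if "S \<in> B" for S
    using Bblock[OF that] block_sub finite_subset[OF _ finite_V] by metis
  have Bdisj: "S = T" if "S \<in> B" "T \<in> B" "v \<in> S" "v \<in> T" for S T v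
    using that Bblock block_eqI by metis
  have bxB: "bx \<in> B" "by \<in> B" and bzB: "\<And>z. z \<in> Z \<Longrightarrow> ?b z \<in> B"
    by (auto simp: B_def)
  have cross: "d \<subseteq> \<Union>B \<and> (\<forall>S\<in>B. \<not> d \<subseteq> S)"
    if "d \<in> E" "d = {a, b}" "a \<in> S1" "b \<in> S2" "S1 \<in> B" "S2 \<in> B" "S1 \<noteq> S2" for d a b S1 S2
    using that Bdisj by blast
  have inb: "a \<in> ?b v" if "a \<in> V" "v \<in> V" "c a = c v" for a v
    using block_class[OF that] block_self by metis
  have D: "d \<in> E \<and> d \<subseteq> \<Union>B \<and> (\<forall>S\<in>B. \<not> d \<subseteq> S)" if "d \<in> D1 \<union> D2" for d
  proof -
    from that consider z where "z \<in> Z" "?b z \<noteq> bx" "d = ex z" | z where "z \<in> Z" "?b z \<noteq> by" "d = ey z"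
      unfolding D1_def D2_def by blast
    then show ?thesis
    proof cases
      case 1
      obtain a b where ab: "d \<in> E" "d = {a, b}" "c a = c x" "c b = c z"
        using ex[OF 1(1)] 1(3) by blast
      have "a \<in> bx" "b \<in> ?b z"
        using edge_pair[of a b] ab inb[of a x] inb[of b z] xy Z(1) 1(1) by (auto simp: bx_def)
      from cross[OF ab(1,2) this bxB(1) bzB[OF 1(1)]] 1(2) ab(1) show ?thesis by auto
    next
      case 2
      obtain a b where ab: "d \<in> E" "d = {a, b}" "c a = c y" "c b = c z"
        using ey[OF 2(1)] 2(3) by blast
      have "a \<in> by" "b \<in> ?b z"
        using edge_pair[of a b] ab inb[of a y] inb[of b z] xy Z(1) 2(1) by (auto simp: by_def)
      from cross[OF ab(1,2) this bxB(2) bzB[OF 2(1)]] 2(2) ab(1) show ?thesis by auto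
    qed
  qed
  have "card U \<le> (\<Sum>S\<in>B. card S)"
    unfolding U_def using card_Union_le_sum_card by blast
  also have "\<dots> \<le> (\<Sum>S\<in>B. 17)"
    using Bblock card_block by (intro sum_mono) metis
  also have "\<dots> = 17 * card B" by simp
  also have "card B \<le> 5"
  proof -
    have "card B \<le> card {bx, by} + card (?b ` Z)" unfolding B_def by (rule card_Un_le)
    also have "card {bx, by} \<le> 2" by (simp add: card_insert_if)
    also have "card (?b ` Z) \<le> 3" using card_image_le[OF Z(3), of ?b] Z(4) by linarith
    finally show ?thesis by simp
  qed
  finally have cU: "card U \<le> 100" by simp
  have "U \<subseteq> V" using Bblock block_sub unfolding U_def by fast
  moreover have "U \<noteq> {}" using block_self[of x] bxB unfolding U_def bx_def by blast
  ultimately have pos: "0 < weight E U" using sparse cU by blast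
  have le: "weight E U \<le> (\<Sum>S\<in>B. weight E S) - 10 * int (card (D1 \<union> D2))"
    unfolding U_def using D Bdisj Bfin finB
    by (intro weight_Union[OF finite_E empty_notin_E]) (auto simp: pairwise_def disjnt_def)
  have split: "(\<Sum>S\<in>B. weight E S) =
      (\<Sum>S\<in>{bx, by}. weight E S) + (\<Sum>S\<in>?b ` {z \<in> Z. ?b z \<notin> {bx, by}}. weight E S)"
  proof -
    have "B = {bx, by} \<union> ?b ` {z \<in> Z. ?b z \<notin> {bx, by}}" unfolding B_def by blast
    then show ?thesis using Z(3) by (simp only:) (subst sum.union_disjoint; auto)
  qed
  have "(\<Sum>S\<in>?b ` {z \<in> Z. ?b z \<notin> {bx, by}}. weight E S)
      \<le> (\<Sum>z | z \<in> Z \<and> ?b z \<notin> {bx, by}. weight E (?b z))"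
  proof -
    have "0 \<le> weight E (?b z)" for z by (cases z rule: block_cases) auto
    then show ?thesis using sum_image_le[of "{z \<in> Z. ?b z \<notin> {bx, by}}" "weight E" ?b] Z(3)
      by (simp add: o_def)
  qed
  also have "\<dots> = (\<Sum>z\<in>Z. if ?b z \<in> {bx, by} then 0 else weight E (?b z))"
    using Z(3) by (subst sum.inter_filter) (auto intro!: sum.cong)
  finally have image_le: "(\<Sum>S\<in>?b ` {z \<in> Z. ?b z \<notin> {bx, by}}. weight E S)
      \<le> (\<Sum>z\<in>Z. if ?b z \<in> {bx, by} then 0 else weight E (?b z))" .
  have s: "10 * int (card {z \<in> Z. \<not> P z}) = (\<Sum>z\<in>Z. if P z then 0 else 10)" for P
    proof -
      have "(\<Sum>z\<in>Z. if P z then 0 else 10) = (\<Sum>z\<in>Z. if \<not> P z then (10::int) else 0)"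
        by (intro sum.cong) auto
      also have "\<dots> = (\<Sum>z | z \<in> Z \<and> \<not> P z. 10)"
        using Z(3) by (subst sum.inter_filter) auto
      finally show ?thesis by simp
    qed
  have cDs: "10 * int (card (D1 \<union> D2)) =
        (\<Sum>z\<in>Z. if ?b z = bx then 0 else 10) + (\<Sum>z\<in>Z. if ?b z = by then 0 else 10)"
      unfolding cD of_nat_add distrib_left s ..
  have two: "sum (weight E) {bx, by} = (if bx = by then weight E bx else weight E bx + weight E by)"
    by simp
  show ?thesis
    using pos le split image_le cDs two by (simp only: sum_subtractf)
qed

text \<open>A 4-cycle in the quotient through a cluster can only be an ear that is about to be attached.\<close>

lemma join_two:
  assumes xy: "x \<in> V" "y \<in> V" "c x \<noteq> c y" and z: "z1 \<in> V" "z2 \<in> V" "c z1 \<noteq> c z2"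
    and adj: "qadj c x z1" "qadj c x z2" "qadj c y z1" "qadj c y z2"
    and x_in: "x \<in> \<Union>F"
  shows "y \<notin> \<Union>F" and "z2 \<in> \<Union>F \<Longrightarrow> z1 \<notin> \<Union>F"
    and "z1 \<in> \<Union>F \<Longrightarrow> block F z1 = block F x \<and> weight E (block F x) = 5"
proof -
  let ?b = "block F"
  have z12: "z1 \<noteq> z2" using z by auto
  have J: "0 < (if ?b x = ?b y then weight E (?b x) else weight E (?b x) + weight E (?b y)) +
    (\<Sum>z\<in>{z1, z2}. (if ?b z \<in> {?b x, ?b y} then 0 else weight E (?b z))
       - (if ?b z = ?b x then 0 else 10) - (if ?b z = ?b y then 0 else 10))"
    by (rule join_weight) (use xy z adj z12 in \<open>auto simp: card_insert_if\<close>)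
  have wx: "?b x \<in> F" "weight E (?b x) \<le> 5" using x_in by (cases x rule: block_cases; auto)+
  have w13: "weight E (?b v) \<le> 13" for v by (cases v rule: block_cases) auto
  have win: "weight E (?b v) \<le> 5" if "v \<in> \<Union>F" for v using that by (cases v rule: block_cases) auto
  \<comment> \<open>In a common block the total starts with at most 5. By absence of 4-cycles one of
    \<open>z1\<close>, \<open>z2\<close> lies outside it and contributes at most
    \<open>13 - 20\<close>.\<close>
  have ne: "?b x \<noteq> ?b y"
  proof
    assume eq: "?b x = ?b y"
    have "\<not> (?b z1 = ?b x \<and> ?b z2 = ?b x)"
    proof
      assume "?b z1 = ?b x \<and> ?b z2 = ?b x"
      then have "{x, y, z1, z2} \<subseteq> ?b x"
        using block_self[of x] block_self[of y] block_self[of z1] block_self[of z2] eq by simp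
      from no_C4_in_cluster[OF wx(1) this adj] show False using xy z by simp
    qed
    then show False
      using J eq z12 wx(2) w13[of z1] w13[of z2] by (auto split: if_splits)
  qed
  have J': "0 < weight E (?b x) + weight E (?b y) +
      ((if ?b z1 \<in> {?b x, ?b y} then -10 else weight E (?b z1) - 20) +
       (if ?b z2 \<in> {?b x, ?b y} then -10 else weight E (?b z2) - 20))"
    using J ne z12 by (auto split: if_splits)
  \<comment> \<open>Two clusters have total weight at most 10, and each of \<open>z1\<close>,
    \<open>z2\<close> takes off at least 7.\<close>
  show y_out: "y \<notin> \<Union>F"
  proof
    assume "y \<in> \<Union>F"
    then show False using J' wx win[of y] w13[of z1] w13[of z2] by (auto split: if_splits)
  qed
  have y13: "weight E (?b y) = 13" "?b y = {y}"
    using y_out by (cases y rule: block_cases; auto)+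
  have nby: "?b v \<noteq> ?b y" if "v \<in> \<Union>F" for v
  proof
    assume "?b v = ?b y"
    then have "v = y" using block_self[of v] y13 by simp
    then show False using that y_out by simp
  qed
  \<comment> \<open>The total starts with at most \<open>5 + 13\<close>. A vertex \<open>z1\<close>
    in another cluster takes off at least 15, one in the block of \<open>x\<close> takes off 10.
    Since \<open>z2\<close> takes off at least 7, or at least 10 if it is covered, only the second
    case with weight 5 and uncovered \<open>z2\<close> survives.\<close>
  have in1: "?b z1 = ?b x \<and> weight E (?b x) = 5 \<and> z2 \<notin> \<Union>F" if "z1 \<in> \<Union>F"
    using J' wx win[OF that] nby[OF that] nby[of z2] win[of z2] w13[of z2] unfolding y13(1)
    by (auto split: if_splits)
  then show "z2 \<in> \<Union>F \<Longrightarrow> z1 \<notin> \<Union>F"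
    "z1 \<in> \<Union>F \<Longrightarrow> ?b z1 = ?b x \<and> weight E (?b x) = 5"
    by auto
qed

text \<open>For different blocks of \<open>x\<close> and \<open>y\<close>, the two contribute at
  most 26 and each of the three neighbours takes off at least 7. This leaves at most 5, the weight
  of K_{2,3}. Every cluster involved lowers the estimate by at least 8, so none is.\<close>

lemma join_three:
  assumes xy: "x \<in> V" "y \<in> V" "c x \<noteq> c y"
    and z: "z1 \<in> V" "z2 \<in> V" "z3 \<in> V" "c z1 \<noteq> c z2" "c z1 \<noteq> c z3" "c z2 \<noteq> c z3"
    and adj: "qadj c x z1" "qadj c x z2" "qadj c x z3" "qadj c y z1" "qadj c y z2" "qadj c y z3"
  shows "x \<notin> \<Union>F" "y \<notin> \<Union>F" "z1 \<notin> \<Union>F" "z2 \<notin> \<Union>F" "z3 \<notin> \<Union>F"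
proof -
  let ?b = "block F"
  have z12: "z1 \<noteq> z2" "z1 \<noteq> z3" "z2 \<noteq> z3" using z by auto
  have J: "0 < (if ?b x = ?b y then weight E (?b x) else weight E (?b x) + weight E (?b y)) +
    (\<Sum>z\<in>{z1, z2, z3}. (if ?b z \<in> {?b x, ?b y} then 0 else weight E (?b z))
       - (if ?b z = ?b x then 0 else 10) - (if ?b z = ?b y then 0 else 10))"
    by (rule join_weight) (use xy z adj z12 in \<open>auto simp: card_insert_if\<close>)
  have w13: "weight E (?b v) \<le> 13" for v by (cases v rule: block_cases) auto
  have win: "weight E (?b v) \<le> 5" if "v \<in> \<Union>F" for v using that by (cases v rule: block_cases) auto
  have out: "?b v = {v}" if "v \<notin> \<Union>F" for v using that by (cases v rule: block_cases) auto
  \<comment> \<open>A common block would be a cluster, and without 4-cycles at most one of the three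
    neighbours lies in it: the total is at most \<open>5 - 7 - 7\<close>.\<close>
  have ne: "?b x \<noteq> ?b y"
  proof
    assume eq: "?b x = ?b y"
    have "x \<in> \<Union>F"
    proof (rule ccontr)
      assume "x \<notin> \<Union>F"
      then show False using out[of x] eq block_self[of y] xy by auto
    qed
    then have wx: "?b x \<in> F" "weight E (?b x) \<le> 5" using block_in_F win by auto
    have C4: "\<not> (?b v = ?b x \<and> ?b v' = ?b x)"
      if "qadj c x v" "qadj c x v'" "qadj c y v" "qadj c y v'" "c v \<noteq> c v'" for v v'
    proof
      assume "?b v = ?b x \<and> ?b v' = ?b x"
      then have "{x, y, v, v'} \<subseteq> ?b x"
        using block_self[of x] block_self[of y] block_self[of v] block_self[of v'] eq by simp
      from no_C4_in_cluster[OF wx(1) this that(1-4)] show False using xy that(5) by simp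
    qed
    note C4' = C4[OF adj(1,2,4,5) z(4)] C4[OF adj(1,3,4,6) z(5)] C4[OF adj(2,3,5,6) z(6)]
    show False
      using C4' J eq z12 wx(2) w13[of z1] w13[of z2] w13[of z3] by (auto split: if_splits)
  qed
  have J': "0 < weight E (?b x) + weight E (?b y) +
      ((if ?b z1 \<in> {?b x, ?b y} then -10 else weight E (?b z1) - 20) +
       (if ?b z2 \<in> {?b x, ?b y} then -10 else weight E (?b z2) - 20) +
       (if ?b z3 \<in> {?b x, ?b y} then -10 else weight E (?b z3) - 20))"
    using J ne z12 by (auto split: if_splits)
  have g: "(if ?b v \<in> {?b x, ?b y} then -10 else weight E (?b v) - 20) \<le> -7" for v
    using w13[of v] by auto
  show x_out: "x \<notin> \<Union>F"
    using J' win[of x] w13[of y] g[of z1] g[of z2] g[of z3] by linarith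
  show y_out: "y \<notin> \<Union>F"
    using J' win[of y] w13[of x] g[of z1] g[of z2] g[of z3] by linarith
  have g': "(if ?b v \<in> {?b x, ?b y} then -10 else weight E (?b v) - 20) \<le> -15" if "v \<in> \<Union>F" for v
  proof -
    have "?b v \<noteq> ?b x" "?b v \<noteq> ?b y"
      using out[OF x_out] out[OF y_out] block_self[of v] that x_out y_out by (metis singletonD)+
    then show ?thesis using win[OF that] by simp
  qed
  show "z1 \<notin> \<Union>F"
    using J' g'[of z1] w13[of x] w13[of y] g[of z1] g[of z2] g[of z3] by linarith
  show "z2 \<notin> \<Union>F"
    using J' g'[of z2] w13[of x] w13[of y] g[of z1] g[of z2] g[of z3] by linarith
  show "z3 \<notin> \<Union>F"
    using J' g'[of z3] w13[of x] w13[of y] g[of z1] g[of z2] g[of z3] by linarith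
qed

section \<open>Enlarging a clustering\<close>

lemma cluster_cong:
  assumes "\<And>x. x \<in> S \<Longrightarrow> c x = c' x" "cluster c S"
  shows "cluster c' S"
proof -
  have "edge_rel c' (E \<inter> Pow S) = edge_rel c (E \<inter> Pow S)"
    using assms(1) by (intro edge_rel_cong[of _ S]) auto
  moreover have "c' ` S = c ` S" using assms(1) by (intro image_cong) auto
  moreover have "{y \<in> S. c' y = c' x} = {y \<in> S. c y = c x}" if "x \<in> S" for x
    using assms(1) that by auto
  ultimately show ?thesis using assms(2) unfolding cluster_def by simp
qed

text \<open>The case \<open>S = {}\<close> starts a new cluster, the other case replaces
  \<open>S\<close> by a larger one. As \<open>c'\<close> takes its values on \<open>X\<close> from
  old labels of \<open>S \<union> X\<close>, no class outside is affected.\<close>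

lemma clustering_extend:
  assumes S: "S \<in> F \<or> S = {}" and X: "X \<subseteq> V - \<Union>F" and c': "\<And>x. x \<notin> X \<Longrightarrow> c' x = c x"
    and im: "c' ` X \<subseteq> c ` (S \<union> X)" and cl: "cluster c' (S \<union> X)"
  shows "clustering c' (insert (S \<union> X) (F - {S}))"
proof -
  have SV: "S \<subseteq> \<Union>F" "S \<subseteq> V" using S Union_F_sub by auto
  have old: "x \<notin> X" "c' x = c x" if "x \<in> \<Union>F" for x using that X c' by auto
  have rep: "\<exists>t\<in>S \<union> X. c' y = c t" if "y \<in> S \<union> X" for y
  proof (cases "y \<in> X")
    case True
    then show ?thesis using im by auto
  next
    case False
    then show ?thesis using that c'[OF False] by blast
  qed
  have cls: "t = y \<or> t \<in> S \<and> y \<in> S" if "y \<in> V" "t \<in> S \<union> X" "c t = c y" for t y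
  proof (cases "t \<in> S")
    case True
    then show ?thesis using F_saturated[of S t y] S that by auto
  next
    case False
    then show ?thesis using outside_inj[of t y] X that by auto
  qed
  show ?thesis
    unfolding clustering_def
  proof (intro conjI ballI impI)
    have dF: "disjnt T T'" if "T \<in> F" "T' \<in> F" "T \<noteq> T'" for T T'
      using F_disjoint[OF that(1,2)] that(3) by (auto simp: disjnt_def)
    have dX: "disjnt T X" if "T \<in> F" for T
      using that X by (auto simp: disjnt_def)
    have dS: "disjnt T S" if "T \<in> F - {S}" for T
      using that S dF[of T S] by (auto simp: disjnt_def)
    show "pairwise disjnt (insert (S \<union> X) (F - {S}))"
      unfolding pairwise_insert
      using dF dX dS by (auto simp: pairwise_def disjnt_Un1 disjnt_Un2 disjnt_sym)
  next
    fix T assume "T \<in> insert (S \<union> X) (F - {S})"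
    then show "cluster c' T"
      using cl cluster_cong[of T c'] old F_cluster[of T] by (metis DiffD1 UnionI insert_iff)
  next
    fix T x y
    assume *: "T \<in> insert (S \<union> X) (F - {S})" "x \<in> T" "y \<in> V" "c' x = c' y"
    show "y \<in> T"
    proof (cases "T = S \<union> X")
      case True
      obtain t where t: "t \<in> S \<union> X" "c' x = c t" using rep[of x] * True by auto
      show ?thesis
      proof (cases "y \<in> X")
        case False
        then show ?thesis using cls[of y t] t c'[of y] * True by auto
      qed (use True in auto)
    next
      case False
      then have T: "T \<in> F" "T \<noteq> S" using * by auto
      have x: "c' x = c x" using old(2)[of x] T * by auto
      show ?thesis
      proof (cases "y \<in> X")
        case True
        then obtain t where t: "t \<in> S \<union> X" "c' y = c t" using rep[of y] by auto
        then have "t \<in> V" using X SV by auto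
        then have "t \<in> T" using F_saturated[OF T(1) *(2), of t] t x * by simp
        then show ?thesis using t T F_disjoint[of T S t] S X by auto
      next
        case False
        then show ?thesis using F_saturated[OF T(1) *(2,3)] x c'[OF False] *(4) by simp
      qed
    qed
  next
    fix x y
    assume *: "x \<in> V - \<Union>(insert (S \<union> X) (F - {S}))" "y \<in> V" "c' x = c' y"
    then have x: "x \<in> V" "x \<notin> X" "x \<notin> S" "x \<notin> \<Union>F" by auto
    show "x = y"
    proof (cases "y \<in> X")
      case True
      then obtain t where t: "t \<in> S \<union> X" "c' y = c t" using rep[of y] by auto
      then have "c x = c t" "t \<in> V" using *(3) c'[OF x(2)] X SV by auto
      then have "x = t" using outside_inj[OF x(1,4)] by auto
      then show ?thesis using t x by auto
    next
      case False
      then show ?thesis using outside_inj[OF x(1,4) *(2)] * c'[OF x(2)] c'[OF False] by simp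
    qed
  qed
qed

text \<open>An uncovered vertex is alone in its class, so the witnessing edge really ends in
  \<open>y\<close>; only its other end may be a twin of \<open>x\<close>.\<close>

lemma qadj_outside:
  assumes "qadj c x y" "x \<in> V" "y \<in> V" "y \<notin> \<Union>F"
  obtains a where "{a, y} \<in> E" "c a = c x" "a \<in> block F x"
proof -
  obtain a b where ab: "{a, b} \<in> E" "c a = c x" "c b = c y" using assms(1) unfolding qadj_def by blast
  have "a \<in> V" "b \<in> V" using edge_pair[OF ab(1)] by auto
  then have "b = y" using outside_inj[OF assms(3,4), of b] ab(3) by simp
  moreover have "a \<in> block F x" using block_class[of a x] block_self[of a] \<open>a \<in> V\<close> assms ab by simp
  ultimately show ?thesis using that ab by blast
qed

lemma qadj_outside2:
  assumes "qadj c x y" "x \<in> V" "y \<in> V" "x \<notin> \<Union>F" "y \<notin> \<Union>F"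
  shows "{x, y} \<in> E"
  using qadj_outside[OF assms(1,2,3,5)] block_outside[OF assms(4)] by auto

end

lemma card_le_2I: "(\<And>u. u \<in> A \<Longrightarrow> u = a \<or> u = b) \<Longrightarrow> card A \<le> 2"
proof -
  assume "\<And>u. u \<in> A \<Longrightarrow> u = a \<or> u = b"
  then have "A \<subseteq> {a, b}" by auto
  then have "card A \<le> card {a, b}" by (intro card_mono) auto
  also have "\<dots> \<le> 2" by (simp add: card_insert_if)
  finally show ?thesis .
qed

context clustered_graph
begin

lemma extend_larger:
  assumes S: "S \<in> F \<or> S = {}" and X: "X \<subseteq> V - \<Union>F" "X \<noteq> {}" and c': "\<And>x. x \<notin> X \<Longrightarrow> c' x = c x"
    and im: "c' ` X \<subseteq> c ` (S \<union> X)" and cl: "cluster c' (S \<union> X)"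
  shows "\<exists>c' F'. clustering c' F' \<and> card (\<Union>F) < card (\<Union>F')"
proof (intro exI conjI)
  show "clustering c' (insert (S \<union> X) (F - {S}))"
    using clustering_extend[OF S X(1) c' im cl] .
  have "\<Union>(insert (S \<union> X) (F - {S})) = \<Union>F \<union> X" using S by auto
  moreover have "\<Union>F \<subset> \<Union>F \<union> X" using X by blast
  moreover have "finite (\<Union>F \<union> X)" using Union_F_sub X finite_V by (meson Diff_subset Un_least finite_subset subset_trans)
  ultimately show "card (\<Union>F) < card (\<Union>(insert (S \<union> X) (F - {S})))"
    by (simp add: psubset_card_mono)
qed

lemma outside_class_neq:
  assumes "x \<in> V - \<Union>F" "y \<in> V" "x \<noteq> y"
  shows "c x \<noteq> c y" "c y \<noteq> c x"
  using outside_inj[of x y] assms by auto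

lemma outside_class_notin:
  assumes "S \<in> F" "v \<in> V - \<Union>F"
  shows "c v \<notin> c ` S"
proof
  assume "c v \<in> c ` S"
  then obtain t where "t \<in> S" "c v = c t" by blast
  then have "v = t" using outside_inj[of v t] assms Union_F_sub by blast
  then show False using assms \<open>t \<in> S\<close> by blast
qed

lemma extend_K23:
  assumes X: "{x, y, z1, z2, z3} \<subseteq> V - \<Union>F" and dist: "distinct [x, y, z1, z2, z3]"
    and ed: "{x, z1} \<in> E" "{x, z2} \<in> E" "{x, z3} \<in> E" "{y, z1} \<in> E" "{y, z2} \<in> E" "{y, z3} \<in> E"
  shows "\<exists>c' F'. clustering c' F' \<and> card (\<Union>F) < card (\<Union>F')"
proof -
  let ?X = "{x, y, z1, z2, z3}"
  define c' where "c' = c(y := c x)"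
  let ?D = "{{x, z1}, {x, z2}, {x, z3}, {y, z1}, {y, z2}, {y, z3}}"
  have cX: "card ?X = 5" using dist by auto
  have cD: "card ?D = 6" using dist by (simp add: doubleton_eq_iff)
  have w0: "weight E {} = 0" "E \<inter> Pow {} = {}" using empty_notin_E by (auto simp: weight_def)
  have neq: "c u \<noteq> c v" if "u \<in> ?X" "v \<in> ?X" "u \<noteq> v" for u v
    using outside_class_neq[of u v] that X by auto
  have ne: "c x \<noteq> c z1" "c x \<noteq> c z2" "c x \<noteq> c z3" "c z1 \<noteq> c z2" "c z1 \<noteq> c z3" "c z2 \<noteq> c z3"
    by (rule neq; use dist in simp)+
  have hyp: "{} \<subseteq> V" "?X \<subseteq> V" "{} \<inter> ?X = {}" "?X \<noteq> {}"
    using X by blast+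
  have hyp2: "card ({} :: 'a set) + card ?X \<le> 100" "?D \<subseteq> E" "?D \<subseteq> Pow ({} \<union> ?X)"
    "weight E {} + 13 * int (card ?X) - 10 * int (card ?D) \<le> 10"
    unfolding cX cD w0 using ed by simp_all
  have hyp3: "\<not> d \<subseteq> {}" if "d \<in> ?D" for d using that by auto
  note ex = exact_extension[OF hyp hyp2(1-3) hyp3 hyp2(4)]
  have inside: "E \<inter> Pow ?X = ?D" and w: "weight E ?X = 5"
    using ex cX cD w0 by simp_all
  have c's: "c' x = c x" "c' y = c x" "c' z1 = c z1" "c' z2 = c z2" "c' z3 = c z3"
    using dist by (auto simp: c'_def)
  have rel: "edge_rel c' ?D =
    {(c x, c z1), (c z1, c x)} \<union> ({(c x, c z2), (c z2, c x)} \<union> ({(c x, c z3), (c z3, c x)} \<union> {}))"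
    by (simp add: c's) blast
  \<comment> \<open>The quotient of K_{2,3} is a star with centre \<open>c x\<close>, built leaf by
    leaf.\<close>
  have C4: "C4_free (edge_rel c' ?D)"
  proof -
    have "C4_free ({(c x, c z3), (c z3, c x)} \<union> {})"
      by (rule C4_free_leaf[OF C4_free_empty, of "{}"]) (use ne in auto)
    then have "C4_free ({(c x, c z2), (c z2, c x)} \<union> ({(c x, c z3), (c z3, c x)} \<union> {}))"
      by (rule C4_free_leaf[where L = "{c x, c z3}"]) (use ne in auto)
    then show ?thesis
      unfolding rel by (rule C4_free_leaf[where L = "{c x, c z2, c z3}"]) (use ne in auto)
  qed
  have im: "c' ` ?X = {c x, c z1, c z2, c z3}" by (auto simp: c's)
  have cim: "card (c' ` ?X) = 4" unfolding im using ne by simp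
  have small: "card {u \<in> ?X. c' u = c' v} \<le> 2" if "v \<in> ?X" for v
  proof (rule card_le_2I)
    fix u assume "u \<in> {u \<in> ?X. c' u = c' v}"
    then show "u = v \<or> u = (if v = x then y else x)"
      using that ne c's by auto
  qed
  \<comment> \<open>Both numerical bounds are attained: \<open>5 + 3 * 5 = 20\<close> and
    \<open>5 + 5 = 6 + 4\<close>.\<close>
  have "cluster c' ?X"
    unfolding cluster_def inside w cim cX
    using X C4 small rel ne by (auto simp: irrefl_def)
  then have cl': "cluster c' ({} \<union> ?X)" by simp
  show ?thesis
  proof (rule extend_larger[OF _ X _ _ _ cl'])
    show "c' t = c t" if "t \<notin> ?X" for t using that by (simp add: c'_def)
    show "c' ` ?X \<subseteq> c ` ({} \<union> ?X)" using X by (simp add: c's)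
  qed (use X in simp_all)
qed

text \<open>An ear of length 4 has 3 new vertices and 4 new edges, so it changes the weight by -1.\<close>

lemma extend_ear4:
  assumes S: "S \<in> F" "x \<in> S" "a1 \<in> S" "a2 \<in> S" "c a1 = c x" "c a2 = c x"
    and X: "{z1, z2, y} \<subseteq> V - \<Union>F" and dist: "distinct [z1, z2, y]"
    and ed: "{a1, z1} \<in> E" "{a2, z2} \<in> E" "{y, z1} \<in> E" "{y, z2} \<in> E"
  shows "\<exists>c' F'. clustering c' F' \<and> card (\<Union>F) < card (\<Union>F')"
proof -
  let ?X = "{z1, z2, y}"
  define c' where "c' = c(z2 := c z1)"
  define R where "R = edge_rel c (E \<inter> Pow S)"
  let ?D = "{{a1, z1}, {a2, z2}, {y, z1}, {y, z2}}"
  have cl: "cluster c S" using F_cluster S by blast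
  note SD = clusterD[OF cl]
  have out: "t \<notin> S" "t \<in> V" if "t \<in> ?X" for t using that X S(1) by auto
  have cX: "card ?X = 3" using dist by auto
  have "a1 \<noteq> z1" "a1 \<noteq> z2" "a1 \<noteq> y" "a2 \<noteq> z1" "a2 \<noteq> z2" "a2 \<noteq> y"
    using out S by auto
  then have cD: "card ?D = 4" using dist by (simp add: doubleton_eq_iff)
  have SX: "S \<inter> ?X = {}" using out by auto
  have hyp: "S \<subseteq> V" "?X \<subseteq> V" "S \<inter> ?X = {}" "?X \<noteq> {}"
    using X SX SD(1) by blast+
  have hyp2: "card S + card ?X \<le> 100" "?D \<subseteq> E" "?D \<subseteq> Pow (S \<union> ?X)"
    "weight E S + 13 * int (card ?X) - 10 * int (card ?D) \<le> 10"
    unfolding cX cD using ed SD(3,4) S(3,4) by simp_all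
  have hyp3: "\<not> d \<subseteq> S" if "d \<in> ?D" for d using that out by auto
  note ex = exact_extension[OF hyp hyp2(1-3) hyp3 hyp2(4)]
  have w: "weight E (S \<union> ?X) = weight E S - 1" using ex(2) cX cD by simp
  have ne: "c z1 \<noteq> c y" "c z1 \<notin> c ` S" "c y \<notin> c ` S"
    using outside_class_neq[of z1 y] outside_class_notin[OF S(1)] X dist by auto
  have nez: "c z1 \<noteq> c x" "c y \<noteq> c x" using ne S by auto
  have neS: "c t \<noteq> c z1" "c t \<noteq> c y" "c z1 \<noteq> c t" "c y \<noteq> c t" if "t \<in> S" for t
    using ne that by (metis image_eqI)+
  have c's: "c' z1 = c z1" "c' z2 = c z1" "c' y = c y" "\<And>t. t \<in> S \<Longrightarrow> c' t = c t"
    using dist out by (auto simp: c'_def)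
  have R: "edge_rel c' (E \<inter> Pow S) = R"
    unfolding R_def using c's by (intro edge_rel_cong[of _ S]) auto
  \<comment> \<open>The four edges of the ear collapse in pairs to a path with two edges starting at
    the class of \<open>x\<close>, so the quotient gains two leaves in succession.\<close>
  have relD: "edge_rel c' ?D = {(c z1, c y), (c y, c z1)} \<union> {(c x, c z1), (c z1, c x)}"
    using S(3-6) by (simp add: c's) blast
  have rel: "edge_rel c' (E \<inter> Pow (S \<union> ?X)) =
    {(c z1, c y), (c y, c z1)} \<union> ({(c x, c z1), (c z1, c x)} \<union> R)"
    using arg_cong[OF ex(1), of "edge_rel c'"] by (simp only: edge_rel_Un R relD Un_ac)
  have R_sub: "R \<subseteq> c ` S \<times> c ` S" unfolding R_def by (rule edge_rel_sub) simp
  have Rok: "C4_free R" "irrefl R" using cl by (auto simp: cluster_def R_def)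
  have "C4_free ({(c x, c z1), (c z1, c x)} \<union> R)"
    using C4_free_leaf[OF Rok(1) R_sub ne(2)] nez by metis
  then have C4: "C4_free ({(c z1, c y), (c y, c z1)} \<union> ({(c x, c z1), (c z1, c x)} \<union> R))"
    by (rule C4_free_leaf[where L = "insert (c z1) (c ` S)"]) (use R_sub ne nez S in auto)
  have im: "c' ` (S \<union> ?X) = insert (c z1) (insert (c y) (c ` S))"
    using c's by (auto simp: image_Un image_iff)
  have cim: "card (c' ` (S \<union> ?X)) = card (c ` S) + 2"
    unfolding im using ne SD(5) by simp
  have cSX: "card (S \<union> ?X) = card S + 3"
    using SX SD(5) cX by (subst card_Un_disjoint) auto
  have small: "card {u \<in> S \<union> ?X. c' u = c' v} \<le> 2" if "v \<in> S \<union> ?X" for v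
  proof (cases "v \<in> S")
    case True
    have "{u \<in> S \<union> ?X. c' u = c' v} = {u \<in> S. c u = c v}"
      using True ne(1) neS[of v] c's by auto
    then show ?thesis using cl True by (simp add: cluster_def)
  next
    case False
    then have "u = v \<or> u = (if v = z1 then z2 else z1)" if "u \<in> {u \<in> S \<union> ?X. c' u = c' v}" for u
      using that \<open>v \<in> S \<union> ?X\<close> ne neS c's by auto
    then show ?thesis by (rule card_le_2I)
  qed
  \<comment> \<open>Three more vertices, two more classes and one unit of weight less: the slack in
    both numerical bounds is unchanged.\<close>
  have "cluster c' (S \<union> ?X)"
    unfolding cluster_def rel w cim cSX
  proof (intro conjI ballI)
    show "irrefl ({(c z1, c y), (c y, c z1)} \<union> ({(c x, c z1), (c z1, c x)} \<union> R))"
      using Rok(2) ne(1) nez by (auto simp: irrefl_def)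
    show "S \<union> ?X \<subseteq> V" using SD(1) X by blast
    show "C4_free ({(c z1, c y), (c y, c z1)} \<union> ({(c x, c z1), (c z1, c x)} \<union> R))" by (rule C4)
    show "card {u \<in> S \<union> ?X. c' u = c' v} \<le> 2" if "v \<in> S \<union> ?X" for v by (rule small[OF that])
    show "1 \<le> weight E S - 1" using ex(3) unfolding w .
  qed (use cl in \<open>simp_all add: cluster_def\<close>)
  then have cl': "cluster c' (S \<union> ?X)" by simp
  show ?thesis
  proof (rule extend_larger[OF _ X _ _ _ cl'])
    show "c' t = c t" if "t \<notin> ?X" for t using that by (simp add: c'_def)
    show "c' ` ?X \<subseteq> c ` (S \<union> ?X)" using S(1) by (simp add: c's)
  qed (use S(1) in simp_all)
qed

text \<open>
  An ear of length 3 costs weight 4, so it fits only a cluster of weight 5. Such a cluster has a single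
  twin pair \<open>{x, x'}\<close>, and therefore the class of \<open>z1\<close>, which receives \<open>z2\<close>, is a singleton.
\<close>

lemma extend_ear3:
  assumes S: "S \<in> F" "x \<in> S" "x' \<in> S" "x' \<noteq> x" "c x' = c x" "weight E S = 5"
    and z1: "z1 \<in> S" "qadj c x z1" and ab: "a \<in> S" "b \<in> S" "c a = c x" "c b = c z1"
    and X: "{z2, y} \<subseteq> V - \<Union>F" and dist: "z2 \<noteq> y"
    and ed: "{a, z2} \<in> E" "{b, y} \<in> E" "{y, z2} \<in> E"
  shows "\<exists>c' F'. clustering c' F' \<and> card (\<Union>F) < card (\<Union>F')"
proof -
  let ?X = "{z2, y}"
  define c' where "c' = c(z2 := c z1)"
  define R where "R = edge_rel c (E \<inter> Pow S)"
  let ?D = "{{a, z2}, {b, y}, {y, z2}}"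
  have cl: "cluster c S" using F_cluster S by blast
  note SD = clusterD[OF cl]
  have out: "t \<notin> S" "t \<in> V" if "t \<in> ?X" for t using that X S(1) by auto
  have cX: "card ?X = 2" using dist by auto
  have "a \<noteq> z2" "a \<noteq> y" "b \<noteq> z2" "b \<noteq> y"
    using out ab by auto
  then have cD: "card ?D = 3" using dist by (simp add: doubleton_eq_iff)
  have SX: "S \<inter> ?X = {}" using out by auto
  have hyp: "S \<subseteq> V" "?X \<subseteq> V" "S \<inter> ?X = {}" "?X \<noteq> {}"
    using X SX SD(1) by blast+
  have hyp2: "card S + card ?X \<le> 100" "?D \<subseteq> E" "?D \<subseteq> Pow (S \<union> ?X)"
    "weight E S + 13 * int (card ?X) - 10 * int (card ?D) \<le> 10"
    unfolding cX cD using ed SD(3,4) S(6) ab by simp_all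
  have hyp3: "\<not> d \<subseteq> S" if "d \<in> ?D" for d using that out by auto
  note ex = exact_extension[OF hyp hyp2(1-3) hyp3 hyp2(4)]
  have w: "weight E (S \<union> ?X) = 1" using ex(2) cX cD S(6) by simp
  have ney: "c y \<notin> c ` S" "c z2 \<notin> c ` S"
    using outside_class_notin[OF S(1)] X by auto
  have nez: "c x \<noteq> c z1" "c y \<noteq> c z1" using qadj_neq[OF z1(2)] ney z1(1) by auto
  have neS: "c t \<noteq> c y" "c y \<noteq> c t" if "t \<in> S" for t
    using ney that by (metis image_eqI)+
  have card_S: "card S \<le> card (c ` S) + 1" "card (c ` S) < card S" "card S \<le> 5"
    using cl S(6) by (auto simp: cluster_def)
  have uniq: "u = z1" if "u \<in> S" "c u = c z1" for u
  proof (rule ccontr)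
    assume "u \<noteq> z1"
    \<comment> \<open>With \<open>u\<close> different from \<open>z1\<close> there would be two twin
      pairs: \<open>x'\<close> and \<open>u\<close> can both be dropped without losing a
      label.\<close>
    have "c ` S = c ` (S - {x', u})"
    proof -
      have "x \<in> S - {x', u}" "z1 \<in> S - {x', u}"
        using S z1 that nez \<open>u \<noteq> z1\<close> by auto
      then have "c x' \<in> c ` (S - {x', u})" "c u \<in> c ` (S - {x', u})"
        using S(5) that(2) by (metis image_eqI)+
      then show ?thesis by blast
    qed
    also have "card \<dots> \<le> card (S - {x', u})" using SD(5) by (intro card_image_le) auto
    also have "\<dots> = card S - 2"
    proof -
      have "x' \<noteq> u" using S(5) that nez by auto
      then show ?thesis using S that SD(5) by (subst card_Diff_subset) auto
    qed
    finally have "card (c ` S) \<le> card S - 2" .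
    \<comment> \<open>Having at least two vertices keeps the truncated \<open>card S - 2\<close>
      honest.\<close>
    moreover have "card {x, x'} \<le> card S" using S SD(5) by (intro card_mono) auto
    ultimately show False using card_S S(4) by simp
  qed
  have c's: "c' z2 = c z1" "c' y = c y" "\<And>t. t \<in> S \<Longrightarrow> c' t = c t"
    using dist out by (auto simp: c'_def)
  have R: "edge_rel c' (E \<inter> Pow S) = R"
    unfolding R_def using c's by (intro edge_rel_cong[of _ S]) auto
  have Rx: "(c x, c z1) \<in> R" "(c z1, c x) \<in> R"
    unfolding R_def using qadj_edge_rel qadj_sym S(1,2) z1 by blast+
  have relD: "edge_rel c' ?D = {(c z1, c y), (c y, c z1)} \<union> {(c x, c z1), (c z1, c x)}"
    using ab by (simp add: c's) blast
  have "edge_rel c' (E \<inter> Pow (S \<union> ?X)) =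
    {(c z1, c y), (c y, c z1)} \<union> ({(c x, c z1), (c z1, c x)} \<union> R)"
    using arg_cong[OF ex(1), of "edge_rel c'"] by (simp only: edge_rel_Un R relD Un_ac)
  \<comment> \<open>The edge from \<open>a\<close> to \<open>z2\<close> falls onto the quotient edge
    between the classes of \<open>x\<close> and \<open>z1\<close>, which exists already. The ear
    adds only the leaf \<open>c y\<close>.\<close>
  also have "{(c x, c z1), (c z1, c x)} \<union> R = R" using Rx by auto
  finally have rel: "edge_rel c' (E \<inter> Pow (S \<union> ?X)) = {(c z1, c y), (c y, c z1)} \<union> R" .
  have R_sub: "R \<subseteq> c ` S \<times> c ` S" unfolding R_def by (rule edge_rel_sub) simp
  have Rok: "C4_free R" "irrefl R" using cl by (auto simp: cluster_def R_def)
  have C4: "C4_free ({(c z1, c y), (c y, c z1)} \<union> R)"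
    using C4_free_leaf[OF Rok(1) R_sub ney(1)] nez by metis
  have im: "c' ` (S \<union> ?X) = insert (c y) (c ` S)"
    using c's z1(1) by (auto simp: image_Un image_iff)
  have cim: "card (c' ` (S \<union> ?X)) = card (c ` S) + 1"
    unfolding im using ney SD(5) by simp
  have cSX: "card (S \<union> ?X) = card S + 2"
    using SX SD(5) cX by (subst card_Un_disjoint) auto
  have small: "card {u \<in> S \<union> ?X. c' u = c' v} \<le> 2" if "v \<in> S \<union> ?X" for v
  proof (cases "v \<in> S \<and> v \<noteq> z1")
    case True
    then have "c v \<noteq> c z1" using uniq by blast
    then have "{u \<in> S \<union> ?X. c' u = c' v} = {u \<in> S. c u = c v}"
      using True neS[of v] neS[OF z1(1)] c's by auto
    then show ?thesis using cl True by (simp add: cluster_def)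
  next
    case False
    have "u = v \<or> u = (if v = z1 then z2 else z1)" if u: "u \<in> {u \<in> S \<union> ?X. c' u = c' v}" for u
    proof -
      have uv: "u \<in> S \<or> u = z2 \<or> u = y" "v = z1 \<or> v = z2 \<or> v = y" "c' u = c' v"
        using u False \<open>v \<in> S \<union> ?X\<close> by auto
      then show ?thesis
        using uniq[of u] neS[of u] neS[OF z1(1)] nez c's(1,2) c's(3)[of u] c's(3)[OF z1(1)]
        by (elim disjE) auto
    qed
    then show ?thesis by (rule card_le_2I)
  qed
  \<comment> \<open>The old cluster has weight 5, hence at most 5 vertices and one pair. The new one
    has weight 1, at most 7 vertices and one more pair, well within the bounds.\<close>
  have "cluster c' (S \<union> ?X)"
    unfolding cluster_def rel w cim cSX
  proof (intro conjI ballI)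
    show "irrefl ({(c z1, c y), (c y, c z1)} \<union> R)"
      using Rok(2) nez by (auto simp: irrefl_def)
    show "S \<union> ?X \<subseteq> V" using SD(1) X by blast
    show "C4_free ({(c z1, c y), (c y, c z1)} \<union> R)" by (rule C4)
    show "card {u \<in> S \<union> ?X. c' u = c' v} \<le> 2" if "v \<in> S \<union> ?X" for v by (rule small[OF that])
  qed (use card_S in simp_all)
  then have cl': "cluster c' (S \<union> ?X)" by simp
  show ?thesis
  proof (rule extend_larger[OF _ X _ _ _ cl'])
    show "c' t = c t" if "t \<notin> ?X" for t using that by (simp add: c'_def)
    show "c' ` ?X \<subseteq> c ` (S \<union> ?X)" using S(1) z1(1) by (simp add: c's)
  qed (use S(1) z1(1) in simp_all)
qed

text \<open>Every counterexample enlarges the family. Common neighbours in three different classes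
  give an uncovered K_{2,3} by \<open>join_three\<close>; two in one class give an ear by
  \<open>join_two\<close>; all three in one class would exceed the class size 2.\<close>

lemma stable:
  assumes maximal: "\<And>c' F'. clustering c' F' \<Longrightarrow> card (\<Union>F') \<le> card (\<Union>F)"
    and xy: "x \<in> V" "y \<in> V" and Z: "card Z = 3" "Z \<subseteq> V"
    and adj: "\<And>z. z \<in> Z \<Longrightarrow> qadj c x z" "\<And>z. z \<in> Z \<Longrightarrow> qadj c y z"
  shows "c x = c y"
proof (rule ccontr)
  assume cxy: "c x \<noteq> c y"
  have no: False if "\<exists>c' F'. clustering c' F' \<and> card (\<Union>F) < card (\<Union>F')"
    using that maximal by (meson not_le)
  obtain z1 z2 z3 where Zeq: "Z = {z1, z2, z3}" and d: "z1 \<noteq> z2" "z1 \<noteq> z3" "z2 \<noteq> z3"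
    using Z(1) by (auto simp: card_3_iff)
  have zV: "z1 \<in> V" "z2 \<in> V" "z3 \<in> V" using Z Zeq by auto
  have q: "qadj c x z1" "qadj c x z2" "qadj c x z3" "qadj c y z1" "qadj c y z2" "qadj c y z3"
    using adj Zeq by auto
  \<comment> \<open>The roles are exchanged: \<open>join_two\<close> is applied to the twin
    \<open>z\<close> and to \<open>t\<close>, with \<open>x\<close> and \<open>y\<close> as their
    common neighbours.\<close>
  have pair: False if z: "z \<in> V" "z' \<in> V" "t \<in> V" "z \<noteq> z'" "c z = c z'" "c z \<noteq> c t"
    and a: "qadj c x z" "qadj c x t" "qadj c y z" "qadj c y t" for z z' t
  proof -
    have zin: "z \<in> \<Union>F" using outside_inj[of z z'] z by blast
    then obtain S where S: "S \<in> F" "z \<in> S" by blast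
    then have S': "z' \<in> S" "block F z = S" using F_saturated z block_F by blast+
    note a' = qadj_sym[OF a(1)] qadj_sym[OF a(2)] qadj_sym[OF a(3)] qadj_sym[OF a(4)]
    note J = join_two[OF z(1,3,6) xy cxy a'(1,3,2,4) zin]
    note J2 = join_two[OF z(1,3,6) xy(2,1) cxy[symmetric] a'(3,1,4,2) zin]
    have tV: "t \<in> V - \<Union>F" using J(1) z by blast
    \<comment> \<open>Here \<open>u\<close> lies in the cluster of \<open>z\<close>, while
      \<open>v\<close> and \<open>t\<close> are uncovered. The path through \<open>v\<close> and
      \<open>t\<close> from the class of \<open>z\<close> to that of \<open>u\<close> is an ear of
      length 3, and \<open>v\<close> becomes a twin of \<open>u\<close>.\<close>
    have ear3: False if u: "u \<in> \<Union>F" "v \<notin> \<Union>F" "block F u = block F z" "weight E (block F z) = 5"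
      and uv: "u \<in> V" "v \<in> V" "qadj c z u" "qadj c z v" "qadj c t u" "qadj c t v" for u v
    proof -
      obtain a where a: "{a, v} \<in> E" "c a = c z" "a \<in> block F z"
        using qadj_outside[OF uv(4) z(1) uv(2) u(2)] by blast
      obtain b where b: "{b, t} \<in> E" "c b = c u" "b \<in> block F u"
        using qadj_outside[OF qadj_sym[OF uv(5)] uv(1) z(3)] tV by blast
      have "{t, v} \<in> E" using qadj_outside2[OF uv(6) z(3) uv(2)] tV u by blast
      moreover have "u \<in> S" using block_self[of u] u S' by simp
      moreover have "v \<noteq> t" using qadj_neq[OF uv(6)] by auto
      ultimately show False
        using a b S S' u tV uv z
        by (intro no extend_ear3[of S z z' u a b v t]) auto
    qed
    consider "x \<notin> \<Union>F" "y \<notin> \<Union>F" | "x \<in> \<Union>F" "y \<notin> \<Union>F" | "y \<in> \<Union>F" "x \<notin> \<Union>F"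
      using J(2) by blast
    then show False
    proof cases
      case 1
      \<comment> \<open>With \<open>x\<close>, \<open>y\<close>, \<open>t\<close> uncovered, two
        paths from the class of \<open>z\<close> through \<open>x\<close> and through
        \<open>y\<close> meet in \<open>t\<close>: an ear of length 4 that makes \<open>x\<close>
        and \<open>y\<close> twins.\<close>
      obtain a1 where a1: "{a1, x} \<in> E" "c a1 = c z" "a1 \<in> block F z"
        using qadj_outside[OF a'(1) z(1) xy(1) 1(1)] by blast
      obtain a2 where a2: "{a2, y} \<in> E" "c a2 = c z" "a2 \<in> block F z"
        using qadj_outside[OF a'(3) z(1) xy(2) 1(2)] by blast
      have "{t, x} \<in> E" "{t, y} \<in> E"
        using qadj_outside2[OF a'(2) z(3) xy(1)] qadj_outside2[OF a'(4) z(3) xy(2)] tV 1 by blast+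
      moreover have "distinct [x, y, t]" using cxy qadj_neq[OF a(2)] qadj_neq[OF a(4)] by auto
      ultimately show False
        using a1 a2 S S' xy 1 tV by (intro no extend_ear4[of S z a1 a2 x y t]) auto
    next
      case 2
      then show False using ear3[of x y] J(3) xy a' by blast
    next
      case 3
      then show False using ear3[of y x] J2(3) xy a' by blast
    qed
  qed
  show False
  proof (cases "c z1 = c z2 \<or> c z1 = c z3 \<or> c z2 = c z3")
    case False
    then have cz: "c z1 \<noteq> c z2" "c z1 \<noteq> c z3" "c z2 \<noteq> c z3" by auto
    note o = join_three[OF xy cxy zV cz q]
    have neq: "u \<noteq> v" if "qadj c u v" for u v using qadj_neq[OF that] by auto
    have ed: "{x, z1} \<in> E" "{x, z2} \<in> E" "{x, z3} \<in> E" "{y, z1} \<in> E" "{y, z2} \<in> E" "{y, z3} \<in> E"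
      by (rule qadj_outside2; use q xy zV o in blast)+
    have dist: "distinct [x, y, z1, z2, z3]" using d cxy q[THEN neq] by auto
    have X: "{x, y, z1, z2, z3} \<subseteq> V - \<Union>F" using xy zV o by simp
    show False by (rule no[OF extend_K23[OF X dist ed]])
  next
    case True
    have three: "\<not> (c z1 = c z2 \<and> c z1 = c z3)"
    proof
      assume eq: "c z1 = c z2 \<and> c z1 = c z3"
      have "z1 \<in> \<Union>F"
        using outside_inj[OF zV(1) _ zV(2)] eq d(1) by blast
      then obtain S where S: "S \<in> F" "z1 \<in> S" by blast
      then have sub: "{z1, z2, z3} \<subseteq> {v \<in> S. c v = c z1}"
        using F_saturated[OF S] eq zV by auto
      have fin: "finite {v \<in> S. c v = c z1}" and le: "card {v \<in> S. c v = c z1} \<le> 2"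
        using F_cluster[OF S(1)] clusterD(5)[OF F_cluster[OF S(1)]] S(2) by (auto simp: cluster_def)
      have "card {z1, z2, z3} \<le> 2" using card_mono[OF fin sub] le by linarith
      then show False using d by simp
    qed
    from True consider "c z1 = c z2" "c z1 \<noteq> c z3" | "c z1 = c z3" "c z1 \<noteq> c z2"
      | "c z2 = c z3" "c z2 \<noteq> c z1"
      using three by metis
    then show False
    proof cases
      case 1
      show False by (rule pair[OF zV d(1) 1 q(1,3,4,6)])
    next
      case 2
      show False by (rule pair[OF zV(1,3,2) d(2) 2 q(1,2,4,5)])
    next
      case 3
      show False by (rule pair[OF zV(2,3,1) d(3) 3 q(2,1,5,4)])
    qed
  qed
qed

lemma class_le_2: "x \<in> V \<Longrightarrow> card {y \<in> V. c y = c x} \<le> 2"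
proof (cases "x \<in> \<Union>F")
  case True
  assume "x \<in> V"
  from True obtain S where S: "S \<in> F" "x \<in> S" by blast
  then have "{y \<in> V. c y = c x} = {y \<in> S. c y = c x}"
    using F_saturated[OF S] clusterD(1)[OF F_cluster[OF S(1)]] by auto
  then show ?thesis using F_cluster[OF S(1)] S(2) by (simp add: cluster_def)
next
  case False
  assume "x \<in> V"
  then have "u = x" if "u \<in> {y \<in> V. c y = c x}" for u
    using outside_inj[of x u] that False by auto
  then show ?thesis by (intro card_le_2I[of _ x x]) blast
qed

end

section \<open>A proper closed supergraph from a maximal clustering\<close>

context sparse_graph
begin

lemma obtain_maximal_clustering:
  obtains c F where "clustered_graph V E c F"
    "\<And>c' F'. clustering c' F' \<Longrightarrow> card (\<Union>F') \<le> card (\<Union>F)"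
proof -
  define P where "P = (\<lambda>k. \<exists>c F. clustering c F \<and> card (\<Union>F) = k)"
  have "P 0"
    unfolding P_def by (intro exI[of _ id] exI[of _ "{}"]) (simp add: clustering_def)
  moreover have "k \<le> card V" if "P k" for k
  proof -
    from that obtain c F where cF: "clustering c F" "card (\<Union>F) = k" unfolding P_def by blast
    interpret clustered_graph V E c F by unfold_locales (rule cF)
    show ?thesis using cF(2) card_mono[OF finite_V Union_F_sub] by simp
  qed
  ultimately obtain m where m: "P m" "\<And>k. P k \<Longrightarrow> k \<le> m"
    using GreatestI_nat[of P 0 "card V"] Greatest_le_nat[of P _ "card V"] by metis
  then obtain c F where cF: "clustering c F" "card (\<Union>F) = m" unfolding P_def by blast
  show ?thesis
  proof (rule that)
    show "clustered_graph V E c F" by unfold_locales (rule cF)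
    show "card (\<Union>F') \<le> card (\<Union>F)" if "clustering c' F'" for c' F'
      using m(2) that unfolding cF P_def by blast
  qed
qed

text \<open>In the blow-up of the quotient, three common neighbours force equal labels by
  \<open>stable\<close>, hence adjacency to the same classes. Were it complete, two vertices from
  different classes would have three common neighbours among the remaining ones; five vertices
  suffice for this.\<close>

lemma twin_closed_supergraph:
  assumes "card V \<ge> 5"
  obtains H where "twin_closed H" "E \<subseteq> H" "H \<subseteq> nsets V 2" "H \<noteq> nsets V 2"
proof -
  obtain c F where cF: "clustered_graph V E c F"
    and maximal: "\<And>c' F'. clustering c' F' \<Longrightarrow> card (\<Union>F') \<le> card (\<Union>F)"
    using obtain_maximal_clustering by blast
  interpret clustered_graph V E c F by (rule cF)
  define H where "H = {{a, b} | a b. a \<in> V \<and> b \<in> V \<and> a \<noteq> b \<and> qadj c a b}"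
  have H_iff: "{a, b} \<in> H \<longleftrightarrow> a \<in> V \<and> b \<in> V \<and> a \<noteq> b \<and> qadj c a b" for a b
    unfolding H_def using qadj_sym[of c] by (auto simp: doubleton_eq_iff)
  have same: "c x = c y"
    if Z: "card Z = 3" "\<And>z. z \<in> Z \<Longrightarrow> {x, z} \<in> H" "\<And>z. z \<in> Z \<Longrightarrow> {y, z} \<in> H" for x y Z
  proof -
    obtain z where "z \<in> Z" using Z(1) by fastforce
    then have "x \<in> V" "y \<in> V" using Z(2,3)[of z] H_iff by auto
    moreover have "Z \<subseteq> V" "qadj c x z" "qadj c y z" if "z \<in> Z" for z
      using Z(2,3) H_iff that by auto
    ultimately show ?thesis
      using \<open>z \<in> Z\<close> Z(1) maximal by (intro stable[of x y Z]) assumption+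
  qed
  show ?thesis
  proof (rule that)
    show "twin_closed H"
      unfolding twin_closed_def
    proof (intro allI impI, elim conjE)
      fix x y v Z
      assume *: "x \<noteq> y" "v \<noteq> x" "card Z = 3" "\<forall>z\<in>Z. {x, z} \<in> H \<and> {y, z} \<in> H" "{y, v} \<in> H"
      then have "c x = c y" using same by blast
      then have "qadj c x v" using *(5) unfolding H_iff qadj_def by simp
      moreover have "x \<in> V"
      proof -
        obtain z where "z \<in> Z" using *(3) by fastforce
        then show ?thesis using *(4) H_iff by blast
      qed
      ultimately show "{x, v} \<in> H" using * H_iff by auto
    qed
    show "E \<subseteq> H"
    proof
      fix e assume e: "e \<in> E"
      then obtain a b where "e = {a, b}" using E_sub by (auto simp: nsets_def card_2_iff)
      moreover have "qadj c a b" unfolding qadj_def using e calculation by blast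
      ultimately show "e \<in> H" using e edge_pair[of a b] H_iff by auto
    qed
    show "H \<subseteq> nsets V 2" unfolding H_def by (auto simp: doubleton_in_nsets_2)
    show "H \<noteq> nsets V 2"
    proof
      assume eq: "H = nsets V 2"
      obtain x where x: "x \<in> V" using assms by fastforce
      have "\<not> V \<subseteq> {y \<in> V. c y = c x}"
      proof
        assume "V \<subseteq> {y \<in> V. c y = c x}"
        then have "card V \<le> card {y \<in> V. c y = c x}" using finite_V by (intro card_mono) auto
        then show False using class_le_2[OF x] assms by simp
      qed
      then obtain y where y: "y \<in> V" "c y \<noteq> c x" by blast
      have "card (V - {x, y}) \<ge> 3"
      proof -
        have "card {x, y} \<le> 2" by (simp add: card_insert_if)
        then show ?thesis using x y assms finite_V by (subst card_Diff_subset) auto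
      qed
      then obtain Z where Z: "Z \<subseteq> V - {x, y}" "card Z = 3"
        by (meson obtain_subset_with_card_n)
      have "{x, z} \<in> H" "{y, z} \<in> H" if "z \<in> Z" for z
        using that Z(1) x y(1) unfolding eq doubleton_in_nsets_2 by blast+
      then have "c x = c y" by (rule same[OF Z(2)])
      then show False using y by simp
    qed
  qed
qed

lemma not_percolates:
  assumes "card V \<ge> 5"
  shows "\<not> percolates K24 (V, E)"
proof -
  obtain H where H: "twin_closed H" "E \<subseteq> H" "H \<subseteq> nsets V 2" "H \<noteq> nsets V 2"
    using twin_closed_supergraph[OF assms] .
  then have "edges (bootstrap_closure K24 (V, E)) \<subseteq> H"
    using bootstrap_closure_least[of H "(V, E)"] by simp
  then show ?thesis
    using H by (auto simp: percolates_def complete_graph_def bootstrap_closure_def)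
qed

end

section \<open>Growth from a seed\<close>

text \<open>
  The vertices 0, 1 are twins through 2, 3, 4; then 8 makes 5, 6 twins and 9 makes 6, 7 twins; the
  three vertices 5, 6, 7 finally make 0, 1, 8, 9 twins.
\<close>

definition seed_edges :: "nat set set" where
  "seed_edges = {{0, 2}, {0, 3}, {0, 4}, {1, 2}, {1, 3}, {1, 4}, {0, 5}, {0, 6}, {0, 7},
     {8, 5}, {8, 6}, {9, 6}, {9, 7}}"

locale closed_graph =
  fixes V :: "'a set" and H :: "'a set set"
  assumes H_sub: "H \<subseteq> nsets V 2" and closed: "twin_closed H"
begin

text \<open>Whether \<open>x\<close> and \<open>y\<close> are themselves adjacent is left open, so
  that one relation covers both nonadjacent twins and the vertices of a complete graph.\<close>

definition tw :: "'a \<Rightarrow> 'a \<Rightarrow> bool" where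
  "tw x y \<longleftrightarrow> (\<forall>v. v \<noteq> x \<and> v \<noteq> y \<longrightarrow> ({x, v} \<in> H \<longleftrightarrow> {y, v} \<in> H))"

lemma H_pair: "{x, y} \<in> H \<Longrightarrow> x \<in> V \<and> y \<in> V \<and> x \<noteq> y"
  using subsetD[OF H_sub, of "{x, y}"] by (simp add: doubleton_in_nsets_2)

lemma H_comm: "{x, y} \<in> H \<Longrightarrow> {y, x} \<in> H"
  by (simp add: insert_commute)

lemma tw_refl: "tw x x"
  by (simp add: tw_def)

lemma tw_sym: "tw x y \<Longrightarrow> tw y x"
  by (auto simp: tw_def)

lemma twD: "tw x y \<Longrightarrow> {x, v} \<in> H \<Longrightarrow> v \<noteq> y \<Longrightarrow> {y, v} \<in> H"
  using H_pair[of x v] by (auto simp: tw_def)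

text \<open>The delicate case is \<open>v = y\<close>: the twins \<open>y\<close>, \<open>z\<close>
  carry \<open>{x, y}\<close> to \<open>{x, z}\<close>, and the twins \<open>x\<close>,
  \<open>y\<close> carry that to \<open>{y, z}\<close>.\<close>

lemma tw_trans:
  assumes "tw x y" "tw y z"
  shows "tw x z"
  unfolding tw_def
proof (intro allI impI)
  fix v assume v: "v \<noteq> x \<and> v \<noteq> z"
  show "{x, v} \<in> H \<longleftrightarrow> {z, v} \<in> H"
  proof (cases "v = y")
    case False
    then show ?thesis using assms v by (auto simp: tw_def)
  next
    case True
    show ?thesis
    proof (cases "x = z")
      case False
      have "{x, y} \<in> H \<longleftrightarrow> {z, x} \<in> H"
        using assms(2) v True False unfolding tw_def by (metis insert_commute)
      moreover have "{x, z} \<in> H \<longleftrightarrow> {y, z} \<in> H"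
        using assms(1) v True False unfolding tw_def by metis
      ultimately show ?thesis using True by (metis insert_commute)
    qed simp
  qed
qed

lemma twI:
  assumes "card Z = 3" "\<And>z. z \<in> Z \<Longrightarrow> {x, z} \<in> H" "\<And>z. z \<in> Z \<Longrightarrow> {y, z} \<in> H"
  shows "tw x y"
proof (cases "x = y")
  case False
  have "{x, v} \<in> H" if "{y, v} \<in> H" "v \<noteq> x" for v
    by (rule twin_closedD[OF closed False that(2) assms that(1)])
  moreover have "{y, v} \<in> H" if "{x, v} \<in> H" "v \<noteq> y" for v
    by (rule twin_closedD[OF closed False[symmetric] that(2) assms(1,3,2) that(1)])
  ultimately show ?thesis unfolding tw_def by blast
qed (simp add: tw_refl)

lemma twI3:
  assumes "z1 \<noteq> z2" "z1 \<noteq> z3" "z2 \<noteq> z3"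
    "{x, z1} \<in> H" "{x, z2} \<in> H" "{x, z3} \<in> H" "{y, z1} \<in> H" "{y, z2} \<in> H" "{y, z3} \<in> H"
  shows "tw x y"
  by (rule twI[of "{z1, z2, z3}"]) (use assms in auto)

text \<open>The elements of \<open>Q\<close> are twins of \<open>s\<close>, so those other than
  \<open>v\<close> are adjacent to \<open>v\<close>, and all are adjacent to \<open>r'\<close>. Four
  of them are required because \<open>v\<close> may be one, and three must remain.\<close>

lemma tw_spread:
  assumes Q: "card Q = 4" "\<And>q. q \<in> Q \<Longrightarrow> tw r q" "\<And>q. q \<in> Q \<Longrightarrow> {r', q} \<in> H"
    and s: "tw r s" "{s, v} \<in> H"
  shows "tw r' v"
proof -
  have fQ: "finite Q" using Q(1) card.infinite by fastforce
  have "3 \<le> card (Q - {v})" using Q(1) fQ by (cases "v \<in> Q") auto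
  then obtain Z where Z: "Z \<subseteq> Q - {v}" "card Z = 3"
    by (meson obtain_subset_with_card_n)
  show ?thesis
  proof (rule twI[OF Z(2)])
    fix z assume "z \<in> Z"
    then have z: "z \<in> Q" "v \<noteq> z" using Z by auto
    show "{r', z} \<in> H" using Q(3) z by blast
    have "tw s z" using tw_trans[OF tw_sym[OF s(1)] Q(2)[OF z(1)]] .
    then have "{z, v} \<in> H" using twD s(2) z(2) by blast
    then show "{v, z} \<in> H" by (rule H_comm)
  qed
qed

text \<open>Connectivity and non-bipartiteness are phrased through cuts, the form that a union bound
  over vertex sets delivers. The seed supplies the four members of each class that
  \<open>tw_spread\<close> asks for: the images of 0, 1, 8, 9 and of 2, 3, 4, 5.\<close>

lemma seed_complete:
  assumes E: "E \<subseteq> H"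
    and connected: "\<And>S. S \<noteq> {} \<Longrightarrow> S \<subset> V \<Longrightarrow> \<exists>a\<in>S. \<exists>b\<in>V - S. {a, b} \<in> E"
    and nonbipartite: "\<And>S. S \<subseteq> V \<Longrightarrow> \<exists>e\<in>E. e \<subseteq> S \<or> e \<subseteq> V - S"
    and inj: "inj_on f {..<10::nat}" and seed: "\<And>e. e \<in> seed_edges \<Longrightarrow> f ` e \<in> E"
  shows "H = nsets V 2"
proof -
  have f: "f i \<noteq> f j" if "i < 10" "j < 10" "i \<noteq> j" for i j
    using inj that by (auto simp: inj_on_def)
  have "\<forall>e\<in>seed_edges. f ` e \<in> H" using seed E by blast
  then have e: "{f 0, f 2} \<in> H" "{f 0, f 3} \<in> H" "{f 0, f 4} \<in> H" "{f 1, f 2} \<in> H" "{f 1, f 3} \<in> H"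
    "{f 1, f 4} \<in> H" "{f 0, f 5} \<in> H" "{f 0, f 6} \<in> H" "{f 0, f 7} \<in> H"
    "{f 8, f 5} \<in> H" "{f 8, f 6} \<in> H" "{f 9, f 6} \<in> H" "{f 9, f 7} \<in> H"
    unfolding seed_edges_def by simp_all
  note e' = e[THEN H_comm]
  have t01: "tw (f 0) (f 1)" by (rule twI3[of "f 2" "f 3" "f 4"]) (use f e in simp_all)
  have e1: "{f 1, f 5} \<in> H" "{f 1, f 6} \<in> H" "{f 1, f 7} \<in> H"
    using twD[OF t01 e(7)] twD[OF t01 e(8)] twD[OF t01 e(9)] f by simp_all
  note e1' = e1[THEN H_comm]
  have t56: "tw (f 5) (f 6)"
    by (rule twI3[of "f 0" "f 1" "f 8"]) (use f e' e1' in simp_all)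
  have t67: "tw (f 6) (f 7)"
    by (rule twI3[of "f 0" "f 1" "f 9"]) (use f e' e1' in simp_all)
  have e2': "{f 7, f 8} \<in> H" "{f 5, f 9} \<in> H"
    using twD[OF t67 e'(11)] twD[OF tw_sym[OF t56] e'(12)] f by simp_all
  note e2 = e2'[THEN H_comm]
  have t08: "tw (f 0) (f 8)"
    by (rule twI3[of "f 5" "f 6" "f 7"]) (use f e e2 in simp_all)
  have t09: "tw (f 0) (f 9)"
    by (rule twI3[of "f 5" "f 6" "f 7"]) (use f e e2 in simp_all)
  have e3: "{f 8, f 2} \<in> H" "{f 8, f 3} \<in> H" "{f 8, f 4} \<in> H"
    using twD[OF t08 e(1)] twD[OF t08 e(2)] twD[OF t08 e(3)] f by simp_all
  note e3' = e3[THEN H_comm]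
  have t2: "tw (f 2) (f 3)" "tw (f 2) (f 4)" "tw (f 2) (f 5)"
    by (rule twI3[of "f 0" "f 1" "f 8"]; use f e' e1' e3' in simp)+
  have e4': "{f 2, f 9} \<in> H" using twD[OF tw_sym[OF t2(3)] e2'(2)] f by simp
  have nbr_A: "tw (f 2) v" if "tw (f 0) s" "{s, v} \<in> H" for s v
  proof (rule tw_spread[of "{f 0, f 1, f 8, f 9}" "f 0", OF _ _ _ that])
    show "card {f 0, f 1, f 8, f 9} = 4" using f by simp
  qed (use tw_refl t01 t08 t09 e' e3' e4' in auto)
  have nbr_B: "tw (f 0) v" if "tw (f 2) s" "{s, v} \<in> H" for s v
  proof (rule tw_spread[of "{f 2, f 3, f 4, f 5}" "f 2", OF _ _ _ that])
    show "card {f 2, f 3, f 4, f 5} = 4" using f by simp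
  qed (use tw_refl t2 e in auto)
  define A where "A = {v \<in> V. tw (f 0) v}"
  define B where "B = {v \<in> V. tw (f 2) v}"
  have f0: "f 0 \<in> A" using H_pair[OF e(1)] tw_refl by (simp add: A_def)
  have AB: "v \<in> B" if "s \<in> A" "{s, v} \<in> H" for s v
    using that nbr_A H_pair by (auto simp: A_def B_def)
  have BA: "v \<in> A" if "s \<in> B" "{s, v} \<in> H" for s v
    using that nbr_B H_pair by (auto simp: A_def B_def)
  have "\<not> A \<union> B \<subset> V"
  proof
    assume sub: "A \<union> B \<subset> V"
    have "A \<union> B \<noteq> {}" using f0 by auto
    from connected[OF this sub] obtain a b
      where ab: "a \<in> A \<union> B" "b \<in> V - (A \<union> B)" "{a, b} \<in> E" by metis
    have abH: "{a, b} \<in> H" using ab(3) E by auto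
    from ab(1) show False
    proof
      assume "a \<in> A"
      from AB[OF this abH] show False using ab(2) by simp
    next
      assume "a \<in> B"
      from BA[OF this abH] show False using ab(2) by simp
    qed
  qed
  then have V: "A \<union> B = V" by (auto simp: A_def B_def)
  have t02: "tw (f 0) (f 2)"
  proof (rule ccontr)
    assume no: "\<not> tw (f 0) (f 2)"
    have disj: "A \<inter> B = {}"
    proof -
      have False if "tw (f 0) v" "tw (f 2) v" for v
        using no tw_trans[OF that(1) tw_sym[OF that(2)]] by simp
      then show ?thesis by (auto simp: A_def B_def)
    qed
    obtain e where e: "e \<in> E" "e \<subseteq> A \<or> e \<subseteq> V - A"
      using nonbipartite[of A] by (auto simp: A_def)
    obtain p q where pq: "e = {p, q}" using e(1) E H_sub by (auto simp: nsets_def card_2_iff)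
    from e(2) show False
    proof
      assume "e \<subseteq> A"
      then have "p \<in> A" "q \<in> A" "{p, q} \<in> H" using pq e E by auto
      then show False using AB[of p q] disj by auto
    next
      assume "e \<subseteq> V - A"
      then have "p \<in> B" "q \<in> B" "{p, q} \<in> H" using pq e E V by auto
      then show False using BA[of p q] disj by auto
    qed
  qed
  have all: "tw (f 0) v" if "v \<in> V" for v
  proof -
    have "v \<in> A \<or> v \<in> B" using that V by blast
    then show ?thesis using tw_trans[OF t02, of v] by (auto simp: A_def B_def)
  qed
  \<comment> \<open>Once all vertices are twins, the single edge \<open>{f 0, f 2}\<close> can be
    moved to any pair, one end at a time.\<close>
  have star: "{f 0, v} \<in> H" if "v \<in> V" "v \<noteq> f 0" for v
  proof (cases "v = f 2")
    case False
    have "tw (f 2) v" using tw_trans[OF tw_sym[OF t02] all[OF that(1)]] .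
    from twD[OF this e'(1)] that have "{v, f 0} \<in> H" by auto
    then show ?thesis by (rule H_comm)
  qed (use e in simp)
  have "{s, t} \<in> H" if "s \<in> V" "t \<in> V" "s \<noteq> t" for s t
  proof (cases "t = f 0")
    case True
    then show ?thesis using star[of s] that H_comm by simp
  next
    case False
    then show ?thesis using twD[OF all[OF that(1)] star[OF that(2)]] that by auto
  qed
  then have "nsets V 2 \<subseteq> H" by (auto simp: nsets_def card_2_iff)
  then show ?thesis using H_sub by blast
qed

end

lemma seed_percolates:
  assumes wf: "edges G \<subseteq> nsets (verts G) 2"
    and "\<And>S. S \<noteq> {} \<Longrightarrow> S \<subset> verts G \<Longrightarrow> \<exists>a\<in>S. \<exists>b\<in>verts G - S. {a, b} \<in> edges G"
    and "\<And>S. S \<subseteq> verts G \<Longrightarrow> \<exists>e\<in>edges G. e \<subseteq> S \<or> e \<subseteq> verts G - S"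
    and "inj_on f {..<10::nat}" "\<And>e. e \<in> seed_edges \<Longrightarrow> f ` e \<in> edges G"
  shows "percolates K24 G"
proof -
  interpret closed_graph "verts G" "edges (bootstrap_closure K24 G)"
    by unfold_locales (rule edges_closure_wf[OF wf], rule twin_closed_bootstrap_closure[OF wf])
  have "edges (bootstrap_closure K24 G) = nsets (verts G) 2"
    by (rule seed_complete[OF edges_subset_closure assms(2-5)])
  then show ?thesis
    by (simp add: percolates_def complete_graph_def bootstrap_closure_def)
qed

section \<open>Random graphs\<close>

lemma finite_pairs: "finite (nsets {..<n::nat} 2)"
  by (simp add: finite_imp_finite_nsets)

lemma set_random_graph:
  "G \<in> set_pmf (random_graph n p) \<Longrightarrow> verts G = {..<n} \<and> edges G \<subseteq> nsets {..<n} 2"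
  by (auto simp: random_graph_def)

lemma finite_set_random_graph: "finite (set_pmf (random_graph n p))"
proof (rule finite_subset)
  show "set_pmf (random_graph n p) \<subseteq> {{..<n}} \<times> Pow (nsets {..<n} 2)"
    using set_random_graph by fastforce
qed (simp add: finite_pairs)

text \<open>An event that constrains each pair separately is a box, so independence turns its
  probability into a product.\<close>

lemma prob_random_graph_Pi:
  "measure_pmf.prob (random_graph n p) {G. \<forall>e\<in>nsets {..<n} 2. P e (e \<in> edges G)} =
     (\<Prod>e\<in>nsets {..<n} 2. measure_pmf.prob (bernoulli_pmf p) {b. P e b})"
proof -
  have "(\<lambda>X. ({..<n}, {e \<in> nsets {..<n} 2. X e})) -` {G. \<forall>e\<in>nsets {..<n} 2. P e (e \<in> edges G)} =
      Pi (nsets {..<n} 2) (\<lambda>e. {b. P e b})"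
    by auto
  then show ?thesis
    unfolding random_graph_def measure_map_pmf
    by (simp add: measure_Pi_pmf_Pi finite_pairs)
qed

lemma prob_bernoulli:
  assumes "0 \<le> p" "p \<le> 1"
  shows "measure_pmf.prob (bernoulli_pmf p) {True} = p" "measure_pmf.prob (bernoulli_pmf p) {False} = 1 - p"
  using assms by (simp_all add: measure_pmf_single)

lemma prob_contains:
  assumes p: "0 \<le> p" "p \<le> 1" and D: "D \<subseteq> nsets {..<n} 2"
  shows "measure_pmf.prob (random_graph n p) {G. D \<subseteq> edges G} = p ^ card D"
proof -
  have "{G. D \<subseteq> edges G} = {G. \<forall>e\<in>nsets {..<n} 2. (e \<in> D \<longrightarrow> e \<in> edges G)}"
    using D by auto
  then have "measure_pmf.prob (random_graph n p) {G :: nat graph. D \<subseteq> edges G} =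
      (\<Prod>e\<in>nsets {..<n} 2. measure_pmf.prob (bernoulli_pmf p) {b. e \<in> D \<longrightarrow> b})"
    using prob_random_graph_Pi[of n p "\<lambda>e b. e \<in> D \<longrightarrow> b"] by simp
  also have "\<dots> = (\<Prod>e\<in>nsets {..<n} 2. if e \<in> D then p else 1)"
  proof (intro prod.cong refl)
    fix e
    have "{b. b} = {True}" by auto
    then show "measure_pmf.prob (bernoulli_pmf p) {b. e \<in> D \<longrightarrow> b} = (if e \<in> D then p else 1)"
      using prob_bernoulli(1)[OF p] by simp
  qed
  also have "\<dots> = p ^ card D"
    using D finite_pairs[of n] by (simp add: prod.If_cases Int_absorb1)
  finally show ?thesis .
qed

lemma prob_avoids:
  assumes p: "0 \<le> p" "p \<le> 1" and D: "D \<subseteq> nsets {..<n} 2"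
  shows "measure_pmf.prob (random_graph n p) {G. D \<inter> edges G = {}} = (1 - p) ^ card D"
proof -
  have "{G. D \<inter> edges G = {}} = {G. \<forall>e\<in>nsets {..<n} 2. (e \<in> D \<longrightarrow> e \<notin> edges G)}"
    using D by auto
  then have "measure_pmf.prob (random_graph n p) {G :: nat graph. D \<inter> edges G = {}} =
      (\<Prod>e\<in>nsets {..<n} 2. measure_pmf.prob (bernoulli_pmf p) {b. e \<in> D \<longrightarrow> \<not> b})"
    using prob_random_graph_Pi[of n p "\<lambda>e b. e \<in> D \<longrightarrow> \<not> b"] by simp
  also have "\<dots> = (\<Prod>e\<in>nsets {..<n} 2. if e \<in> D then 1 - p else 1)"
  proof (intro prod.cong refl)
    fix e
    have "{b. \<not> b} = {False}" by auto
    then show "measure_pmf.prob (bernoulli_pmf p) {b. e \<in> D \<longrightarrow> \<not> b} = (if e \<in> D then 1 - p else 1)"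
      using prob_bernoulli(2)[OF p] by simp
  qed
  also have "\<dots> = (1 - p) ^ card D"
    using D finite_pairs[of n] by (simp add: prod.If_cases Int_absorb1)
  finally show ?thesis .
qed

lemma prob_avoids_le:
  assumes p: "0 \<le> p" "p \<le> 1" and D: "D \<subseteq> nsets {..<n} 2"
  shows "measure_pmf.prob (random_graph n p) {G. D \<inter> edges G = {}} \<le> exp (- p * real (card D))"
proof -
  have "(1 - p) ^ card D \<le> exp (- p) ^ card D"
    using p exp_ge_add_one_self[of "- p"] by (intro power_mono) auto
  also have "\<dots> = exp (- p * real (card D))"
    by (simp add: exp_of_nat_mult[symmetric] mult.commute)
  finally show ?thesis using prob_avoids[OF assms] by simp
qed

text \<open>The covering is demanded on the support only, so that facts true of every sampled graph,
  such as its vertex set, are available.\<close>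

lemma prob_union_bound:
  fixes M :: "'a pmf"
  assumes "finite I" and "\<And>x. x \<in> set_pmf M \<Longrightarrow> x \<in> B \<Longrightarrow> \<exists>i\<in>I. x \<in> A i"
  shows "measure_pmf.prob M B \<le> (\<Sum>i\<in>I. measure_pmf.prob M (A i))"
proof -
  have "measure_pmf.prob M B = measure_pmf.prob M (B \<inter> set_pmf M)"
    by (simp add: measure_Int_set_pmf)
  also have "\<dots> \<le> measure_pmf.prob M (\<Union>i\<in>I. A i)"
    by (intro measure_pmf.finite_measure_mono) (use assms(2) in auto)
  also have "\<dots> \<le> (\<Sum>i\<in>I. measure_pmf.prob M (A i))"
    using assms(1) by (intro measure_pmf.finite_measure_subadditive_finite) auto
  finally show ?thesis .
qed

text \<open>The binomial theorem indexed by subsets, which puts union bounds over vertex sets into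
  closed form.\<close>

lemma sum_Pow_power_card:
  fixes q :: "'b :: comm_semiring_1"
  assumes "finite A"
  shows "(\<Sum>S\<in>Pow A. q ^ card S) = (1 + q) ^ card A"
  using prod_add[OF assms, of "\<lambda>_. q" "\<lambda>_. 1"] by (simp add: add.commute)

section \<open>First moment below the threshold\<close>

lemma percolation_witness:
  assumes n: "5 \<le> (n::nat)" and G: "verts G = {..<n}" "edges G \<subseteq> nsets {..<n} 2" and perc: "percolates K24 G"
  obtains S D where "S \<subseteq> {..<n}" "S \<noteq> {}" "D \<subseteq> nsets S 2" "card S \<le> 100"
    "13 * card S \<le> 10 * card D" "D \<subseteq> edges G"
proof -
  have "\<not> sparse_graph {..<n} (edges G)"
  proof
    assume "sparse_graph {..<n} (edges G)"
    then have "\<not> percolates K24 ({..<n}, edges G)"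
      using n by (intro sparse_graph.not_percolates) auto
    then show False using perc G(1) by (metis prod.collapse)
  qed
  then obtain S where S: "S \<subseteq> {..<n}" "S \<noteq> {}" "card S \<le> 100" "\<not> weight (edges G) S > 0"
    using G(2) unfolding sparse_graph_def by auto
  show ?thesis
  proof (rule that[OF S(1,2) _ S(3)])
    show "edges G \<inter> Pow S \<subseteq> nsets S 2" using G(2) by (auto simp: nsets_def)
    show "13 * card S \<le> 10 * card (edges G \<inter> Pow S)"
      using S(4) by (simp add: weight_def)
  qed auto
qed

text \<open>Nonpositive weight means \<open>d \<ge> 13 / 10 * s\<close>, and this exponent turns
  \<open>n powr (- 10 / 13)\<close> into \<open>n powr (- s)\<close>. The constant receives an
  exponent of at least 1, so one factor \<open>c\<close> survives to make the final sum
  small.\<close>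

lemma dense_power_le:
  fixes c p :: real
  assumes n: "0 < n" and p: "0 \<le> p" "p \<le> 1" "p \<le> c * real n powr (- 10 / 13)"
    and c: "0 < c" "c \<le> 1" and s: "0 < s" and d: "13 * s \<le> 10 * (d::nat)"
  shows "p ^ d \<le> c * (1 / real n) ^ s"
proof (cases "p = 0")
  case True
  then show ?thesis using s d c by (simp add: power_0_left)
next
  case False
  then have p0: "0 < p" using p by simp
  have sd: "13 * real s \<le> 10 * real d" using d by linarith
  have "p ^ d = p powr real d" using p0 by (simp add: powr_realpow)
  also have "\<dots> \<le> p powr (13 / 10 * real s)"
    using sd p0 p(2) by (intro powr_mono') auto
  also have "\<dots> \<le> (c * real n powr (- 10 / 13)) powr (13 / 10 * real s)"
    using p p0 by (intro powr_mono2) auto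
  also have "\<dots> = c powr (13 / 10 * real s) * real n powr (- real s)"
    using c n by (simp add: powr_mult powr_powr)
  also have "\<dots> \<le> c powr 1 * real n powr (- real s)"
  proof (intro mult_right_mono powr_mono')
    have "1 \<le> real s" using s by simp
    then show "1 \<le> 13 / 10 * real s" by linarith
  qed (use c in auto)
  also have "\<dots> = c * (1 / real n) ^ s"
    using c n by (simp add: powr_minus powr_realpow power_divide inverse_eq_divide)
  finally show ?thesis .
qed

text \<open>The exponent \<open>b\<close> is a variable to keep the simplifier from evaluating its value 4950 as a power.\<close>

lemma prob_percolates_small:
  fixes c p :: real
  assumes n: "5 \<le> n" and p: "0 \<le> p" "p \<le> 1" "p \<le> c * real n powr (- 10 / 13)"
    and c: "0 < c" "c \<le> 1" and b: "b = 100 choose 2"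
  shows "measure_pmf.prob (random_graph n p) {G. percolates K24 G} \<le> 3 * 2 ^ b * c"
proof -
  define I where "I = (SIGMA S:{S \<in> Pow {..<n} - {{}}. card S \<le> 100}.
    {D \<in> Pow (nsets S 2). 13 * card S \<le> 10 * card D})"
  let ?K = "2 ^ b :: real"
  have finS: "finite (nsets S 2)" if "S \<subseteq> {..<n}" for S
    using that by (simp add: finite_imp_finite_nsets finite_subset)
  have finI: "finite I" unfolding I_def by (intro finite_SigmaI) (use finS in auto)
  have "measure_pmf.prob (random_graph n p) {G. percolates K24 G}
      \<le> (\<Sum>(S, D)\<in>I. measure_pmf.prob (random_graph n p) {G. D \<subseteq> edges G})"
    unfolding split_def
  proof (rule prob_union_bound[OF finI])
    fix G assume G: "G \<in> set_pmf (random_graph n p)" "G \<in> {G. percolates K24 G}"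
    have "verts G = {..<n}" "edges G \<subseteq> nsets {..<n} 2" "percolates K24 G"
      using set_random_graph[OF G(1)] G(2) by auto
    from percolation_witness[OF n this] obtain S D where "S \<subseteq> {..<n}" "S \<noteq> {}" "D \<subseteq> nsets S 2" "card S \<le> 100"
      "13 * card S \<le> 10 * card D" "D \<subseteq> edges G" .
    then show "\<exists>i\<in>I. G \<in> {G. snd i \<subseteq> edges G}"
      by (intro bexI[of _ "(S, D)"]) (auto simp: I_def)
  qed
  also have "\<dots> \<le> (\<Sum>(S, D)\<in>I. c * (1 / real n) ^ card S)"
  proof (intro sum_mono, clarify)
    fix S D assume "(S, D) \<in> I"
    then have SD: "S \<subseteq> {..<n}" "S \<noteq> {}" "D \<subseteq> nsets S 2" "13 * card S \<le> 10 * card D"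
      by (auto simp: I_def)
    have "card S > 0" using SD finite_subset by (auto simp: card_gt_0_iff)
    moreover have "D \<subseteq> nsets {..<n} 2" using SD nsets_mono by blast
    ultimately show "measure_pmf.prob (random_graph n p) {G. D \<subseteq> edges G} \<le> c * (1 / real n) ^ card S"
      using dense_power_le[OF _ p c _ SD(4)] n prob_contains[OF p(1,2)] by simp
  qed
  also have "\<dots> = (\<Sum>S\<in>{S \<in> Pow {..<n} - {{}}. card S \<le> 100}.
      \<Sum>D\<in>{D \<in> Pow (nsets S 2). 13 * card S \<le> 10 * card D}. c * (1 / real n) ^ card S)"
    unfolding I_def by (subst sum.Sigma) (use finS in auto)
  also have "\<dots> \<le> (\<Sum>S\<in>{S \<in> Pow {..<n} - {{}}. card S \<le> 100}. ?K * (c * (1 / real n) ^ card S))"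
  proof (intro sum_mono)
    fix S assume "S \<in> {S \<in> Pow {..<n} - {{}}. card S \<le> 100}"
    then have S: "S \<subseteq> {..<n}" "card S \<le> 100" by auto
    have "card {D \<in> Pow (nsets S 2). 13 * card S \<le> 10 * card D} \<le> card (Pow (nsets S 2))"
      using finS[OF S(1)] by (intro card_mono) auto
    also have "\<dots> = 2 ^ (card S choose 2)"
      using finS[OF S(1)] finite_subset[OF S(1)] by (simp add: card_Pow card_nsets)
    also have "\<dots> \<le> 2 ^ b"
    proof (intro power_increasing)
      have "card S * (card S - 1) \<le> 100 * (100 - 1)" using S(2) by (intro mult_mono) auto
      then show "card S choose 2 \<le> b" unfolding b choose_two by (rule div_le_mono)
    qed auto
    finally have "real (card {D \<in> Pow (nsets S 2). 13 * card S \<le> 10 * card D}) \<le> ?K"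
      by (metis (mono_tags) of_nat_le_iff of_nat_numeral of_nat_power)
    then show "(\<Sum>D\<in>{D \<in> Pow (nsets S 2). 13 * card S \<le> 10 * card D}. c * (1 / real n) ^ card S)
        \<le> ?K * (c * (1 / real n) ^ card S)"
      unfolding sum_constant using c by (intro mult_right_mono) auto
  qed
  \<comment> \<open>Forgetting the size bound on \<open>S\<close> makes the sum binomial, with the
    value \<open>(1 + 1 / n) ^ n\<close> up to the constant.\<close>
  also have "\<dots> \<le> (\<Sum>S\<in>Pow {..<n}. ?K * (c * (1 / real n) ^ card S))"
    using c by (intro sum_mono2) auto
  also have "\<dots> = ?K * c * (1 + 1 / real n) ^ n"
    using sum_Pow_power_card[of "{..<n}" "1 / real n"] by (simp add: sum_distrib_left[symmetric] mult.assoc)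
  also have "(1 + 1 / real n) ^ n \<le> 3"
  proof -
    have "(1 + 1 / real n) ^ n \<le> exp (1 / real n) ^ n"
      using exp_ge_add_one_self[of "1 / real n"] by (intro power_mono) auto
    also have "\<dots> = exp 1" using n by (simp add: exp_of_nat_mult[symmetric])
    finally show ?thesis using exp_le by linarith
  qed
  finally show ?thesis using c by (simp add: mult_ac mult_left_mono)
qed

section \<open>Second moment for copies of the seed\<close>

lemma second_moment_none:
  fixes M :: "'a pmf" and A :: "'i \<Rightarrow> 'a set"
  assumes fin: "finite (set_pmf M)" "finite I"
    and \<mu>: "\<mu> = (\<Sum>i\<in>I. measure_pmf.prob M (A i))" "0 < \<mu>"
  shows "measure_pmf.prob M {x. \<forall>i\<in>I. x \<notin> A i} \<le>
    (\<Sum>i\<in>I. \<Sum>j\<in>I. measure_pmf.prob M (A i \<inter> A j)) / \<mu>\<^sup>2 - 1"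
proof -
  define X where "X = (\<lambda>x. \<Sum>i\<in>I. indicator (A i) x :: real)"
  have int: "integrable (measure_pmf M) f" for f :: "'a \<Rightarrow> real"
    using fin(1) by (rule integrable_measure_pmf_finite)
  have EX: "measure_pmf.expectation M X = \<mu>"
    unfolding X_def \<mu> by (subst Bochner_Integration.integral_sum) (auto intro: int)
  have X2: "(X x)\<^sup>2 = (\<Sum>i\<in>I. \<Sum>j\<in>I. indicator (A i \<inter> A j) x)" for x
    unfolding X_def power2_eq_square sum_product by (simp add: indicator_inter_arith)
  have EX2: "measure_pmf.expectation M (\<lambda>x. (X x)\<^sup>2) = (\<Sum>i\<in>I. \<Sum>j\<in>I. measure_pmf.prob M (A i \<inter> A j))"
    unfolding X2 by (subst Bochner_Integration.integral_sum, rule int,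
      intro sum.cong refl, subst Bochner_Integration.integral_sum) (auto intro: int)
  \<comment> \<open>If none of the events occurs, the count \<open>X\<close> is 0 and deviates from
    its mean by \<open>\<mu>\<close>.\<close>
  have "{x. \<forall>i\<in>I. x \<notin> A i} \<subseteq> {x \<in> space (measure_pmf M). \<mu> \<le> \<bar>X x - measure_pmf.expectation M X\<bar>}"
    using \<mu>(2) unfolding EX by (auto simp: X_def)
  then have "measure_pmf.prob M {x. \<forall>i\<in>I. x \<notin> A i} \<le>
      measure_pmf.prob M {x \<in> space (measure_pmf M). \<mu> \<le> \<bar>X x - measure_pmf.expectation M X\<bar>}"
    by (intro measure_pmf.finite_measure_mono) auto
  also have "\<dots> \<le> measure_pmf.variance M X / \<mu>\<^sup>2"
    using \<mu>(2) int by (intro measure_pmf.Chebyshev_inequality) auto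
  also have "measure_pmf.variance M X = measure_pmf.expectation M (\<lambda>x. (X x)\<^sup>2) - \<mu>\<^sup>2"
    using int EX by (subst measure_pmf.variance_eq) auto
  finally show ?thesis using \<mu>(2) unfolding EX2 by (simp add: diff_divide_distrib)
qed

lemma seed_edges_sub: "seed_edges \<subseteq> nsets {..<10} 2"
  by (simp add: seed_edges_def)

lemma finite_seed_edges: "finite seed_edges"
  by (simp add: seed_edges_def)

lemma card_seed_edges: "card seed_edges = 13"
  by (simp add: seed_edges_def doubleton_eq_iff)

text \<open>Strict balance in terms of the indicators of the ten vertices: a finite check over all
  nonempty proper subsets, with the 13 edges written out. The summand 1 expresses that the integral
  weight is positive.\<close>

lemma seed_bool_inequality:
  fixes b0 b1 b2 b3 b4 b5 b6 b7 b8 b9 :: bool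
  assumes "\<not> (b0 \<and> b1 \<and> b2 \<and> b3 \<and> b4 \<and> b5 \<and> b6 \<and> b7 \<and> b8 \<and> b9)"
    and "b0 \<or> b1 \<or> b2 \<or> b3 \<or> b4 \<or> b5 \<or> b6 \<or> b7 \<or> b8 \<or> b9"
  shows "10 * (of_bool (b0 \<and> b2) + of_bool (b0 \<and> b3) + of_bool (b0 \<and> b4) + of_bool (b1 \<and> b2)
     + of_bool (b1 \<and> b3) + of_bool (b1 \<and> b4) + of_bool (b0 \<and> b5) + of_bool (b0 \<and> b6) + of_bool (b0 \<and> b7)
     + of_bool (b8 \<and> b5) + of_bool (b8 \<and> b6) + of_bool (b9 \<and> b6) + of_bool (b9 \<and> b7)) + (1::nat)
   \<le> 13 * (of_bool b0 + of_bool b1 + of_bool b2 + of_bool b3 + of_bool b4 + of_bool b5 + of_bool b6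
     + of_bool b7 + of_bool b8 + of_bool b9)"
  using assms
  by (cases b0; cases b6; cases b1; cases b8; cases b9; cases b2; cases b3; cases b4; cases b5; cases b7; simp)

lemma sum_seed_edges:
  fixes h :: "nat set \<Rightarrow> nat"
  shows "sum h seed_edges = h {0, 2} + h {0, 3} + h {0, 4} + h {1, 2} + h {1, 3} + h {1, 4}
    + h {0, 5} + h {0, 6} + h {0, 7} + h {8, 5} + h {8, 6} + h {9, 6} + h {9, 7}"
  by (simp add: seed_edges_def doubleton_eq_iff)

lemma lessThan_10: "{..<10::nat} = {0, 1, 2, 3, 4, 5, 6, 7, 8, 9}"
  by (simp add: lessThan_Suc eval_nat_numeral insert_commute)

lemma sum_lessThan_10:
  fixes h :: "nat \<Rightarrow> nat"
  shows "sum h {..<10} = h 0 + h 1 + h 2 + h 3 + h 4 + h 5 + h 6 + h 7 + h 8 + h 9"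
  unfolding lessThan_10 by simp

lemma seed_strictly_balanced:
  assumes T: "T \<subseteq> {..<10}" "T \<noteq> {}" "T \<noteq> {..<10}"
  shows "10 * card (seed_edges \<inter> Pow T) + 1 \<le> 13 * card T"
proof -
  have "card (seed_edges \<inter> Pow T) = (\<Sum>e\<in>seed_edges. of_bool (e \<subseteq> T))"
    using finite_seed_edges by (simp add: Int_def)
  note e = this[unfolded sum_seed_edges insert_subset]
  have "card T = card ({..<10} \<inter> T)" using T(1) by (simp add: Int_absorb1)
  also have "\<dots> = (\<Sum>i\<in>{..<10}. of_bool (i \<in> T))" by (simp add: Int_def)
  finally have c: "card T = (\<Sum>i\<in>{..<10}. of_bool (i \<in> T))" .
  note c = this[unfolded sum_lessThan_10]
  have "\<not> (0 \<in> T \<and> 1 \<in> T \<and> 2 \<in> T \<and> 3 \<in> T \<and> 4 \<in> T \<and> 5 \<in> T \<and> 6 \<in> T \<and> 7 \<in> T \<and> 8 \<in> T \<and> 9 \<in> T)"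
    using T unfolding lessThan_10 by blast
  moreover have "0 \<in> T \<or> 1 \<in> T \<or> 2 \<in> T \<or> 3 \<in> T \<or> 4 \<in> T \<or> 5 \<in> T \<or> 6 \<in> T \<or> 7 \<in> T \<or> 8 \<in> T \<or> 9 \<in> T"
    using T unfolding lessThan_10 by blast
  ultimately show ?thesis
    using seed_bool_inequality[of "0 \<in> T" "1 \<in> T" "2 \<in> T" "3 \<in> T" "4 \<in> T" "5 \<in> T" "6 \<in> T"
      "7 \<in> T" "8 \<in> T" "9 \<in> T"] unfolding e c by (simp only: empty_subsetI simp_thms)
qed

text \<open>
  The vertices of the seed are mapped to disjoint intervals. Then two copies of the seed share exactly
  the vertices on which their maps agree.
\<close>

definition seed_maps :: "nat \<Rightarrow> (nat \<Rightarrow> nat) set" where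
  "seed_maps m = PiE {..<10} (\<lambda>i. {i * m..<(i + 1) * m})"

lemma seed_mapsD: "f \<in> seed_maps m \<Longrightarrow> i < 10 \<Longrightarrow> i * m \<le> f i \<and> f i < (i + 1) * m"
  unfolding seed_maps_def by (drule PiE_mem[where x = i]) auto

lemma seed_maps_eq:
  assumes "f \<in> seed_maps m" "g \<in> seed_maps m" "i < 10" "j < 10" "f i = g j"
  shows "i = j"
proof -
  have f: "i * m \<le> f i" "f i < (i + 1) * m" and g: "j * m \<le> g j" "g j < (j + 1) * m"
    using seed_mapsD assms(1-4) by blast+
  have "i * m < (j + 1) * m" "j * m < (i + 1) * m"
    using f g assms(5) by linarith+
  then have "i < j + 1" "j < i + 1" by (metis mult_less_cancel2)+
  then show ?thesis by simp
qed

lemma seed_maps_inj: "f \<in> seed_maps m \<Longrightarrow> inj_on f {..<10}"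
  using seed_maps_eq[of f m f] by (auto simp: inj_on_def)

lemma seed_maps_less:
  assumes "f \<in> seed_maps m" "10 * m \<le> n" "i < 10"
  shows "f i < n"
proof -
  have "f i < (i + 1) * m" using seed_mapsD assms by blast
  also have "\<dots> \<le> 10 * m" using assms(3) by (intro mult_right_mono) auto
  finally show ?thesis using assms(2) by simp
qed

lemma finite_seed_maps: "finite (seed_maps m)"
  by (simp add: seed_maps_def finite_PiE)

lemma card_seed_maps_agree:
  assumes "f \<in> seed_maps m" "T \<subseteq> {..<10}"
  shows "card {g \<in> seed_maps m. {i \<in> {..<10}. f i = g i} = T} \<le> m ^ (10 - card T)"
proof -
  let ?P = "PiE {..<10} (\<lambda>i. if i \<in> T then {f i} else {i * m..<(i + 1) * m})"
  have "{g \<in> seed_maps m. {i \<in> {..<10}. f i = g i} = T} \<subseteq> ?P"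
  proof
    fix g assume "g \<in> {g \<in> seed_maps m. {i \<in> {..<10}. f i = g i} = T}"
    then have g: "g \<in> seed_maps m" and T: "{i \<in> {..<10}. f i = g i} = T" by blast+
    show "g \<in> ?P"
    proof (rule PiE_I)
      fix i assume i: "i \<in> {..<10::nat}"
      show "g i \<in> (if i \<in> T then {f i} else {i * m..<(i + 1) * m})"
      proof (cases "i \<in> T")
        case True
        then have "i \<in> {i \<in> {..<10}. f i = g i}" unfolding T .
        then show ?thesis using True by simp
      qed (use seed_mapsD[OF g, of i] i in simp)
    next
      fix i assume "i \<notin> {..<10::nat}"
      then show "g i = undefined" using g PiE_arb unfolding seed_maps_def by fast
    qed
  qed
  then have "card {g \<in> seed_maps m. {i \<in> {..<10}. f i = g i} = T} \<le> card ?P"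
    by (intro card_mono finite_PiE) auto
  also have "\<dots> = (\<Prod>i<10. if i \<in> T then 1 else m)"
    by (subst card_PiE) (auto intro!: prod.cong)
  also have "\<dots> = m ^ card ({..<10} - T)"
    by (simp add: prod.If_cases Diff_eq)
  also have "card ({..<10} - T) = 10 - card T"
    using assms(2) by (subst card_Diff_subset) (auto intro: finite_subset)
  finally show ?thesis .
qed

lemma card_seed_maps: "card (seed_maps m) = m ^ 10"
  by (simp add: seed_maps_def card_PiE)

lemma inj_on_image_sets: "inj_on f A \<Longrightarrow> inj_on ((`) f) (nsets A k)"
  by (rule inj_on_subset[OF inj_on_image_Pow]) (auto simp: nsets_def)

lemma card_seed_image: "f \<in> seed_maps m \<Longrightarrow> card ((`) f ` seed_edges) = 13"
  using card_image[OF inj_on_subset[OF inj_on_image_sets[OF seed_maps_inj] seed_edges_sub]]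
    card_seed_edges by metis

text \<open>Since \<open>f i = g j\<close> forces \<open>i = j\<close>, a common edge of the two
  copies has both ends in the agreement set, so at most
  \<open>card (seed_edges \<inter> Pow T)\<close> of the \<open>13 + 13\<close> edges are counted
  twice.\<close>

lemma card_seed_overlap:
  assumes f: "f \<in> seed_maps m" and g: "g \<in> seed_maps m"
  defines "T \<equiv> {i \<in> {..<10}. f i = g i}"
  shows "26 - card (seed_edges \<inter> Pow T) \<le> card ((`) f ` seed_edges \<union> (`) g ` seed_edges)"
proof -
  have "(`) f ` seed_edges \<inter> (`) g ` seed_edges \<subseteq> (`) f ` (seed_edges \<inter> Pow T)"
  proof
    fix d assume "d \<in> (`) f ` seed_edges \<inter> (`) g ` seed_edges"
    then obtain e e' where e: "e \<in> seed_edges" "e' \<in> seed_edges" "d = f ` e" "f ` e = g ` e'" by blast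
    have lt: "i < 10" if "i \<in> e \<or> i \<in> e'" for i
      using that e(1,2) seed_edges_sub by (auto simp: nsets_def)
    have "e \<subseteq> T"
    proof
      fix i assume i: "i \<in> e"
      then have "f i \<in> g ` e'" using e(4) by blast
      then obtain j where j: "j \<in> e'" "f i = g j" by blast
      then have "i = j" using seed_maps_eq[OF f g] lt i by blast
      then show "i \<in> T" using j i lt by (simp add: T_def)
    qed
    then show "d \<in> (`) f ` (seed_edges \<inter> Pow T)" using e by blast
  qed
  then have "card ((`) f ` seed_edges \<inter> (`) g ` seed_edges) \<le> card ((`) f ` (seed_edges \<inter> Pow T))"
    by (intro card_mono) (simp_all add: finite_seed_edges)
  also have "\<dots> \<le> card (seed_edges \<inter> Pow T)"
    by (intro card_image_le) (simp add: finite_seed_edges)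
  finally have "card ((`) f ` seed_edges \<inter> (`) g ` seed_edges) \<le> card (seed_edges \<inter> Pow T)" .
  moreover have "card ((`) f ` seed_edges) + card ((`) g ` seed_edges) =
      card ((`) f ` seed_edges \<union> (`) g ` seed_edges) + card ((`) f ` seed_edges \<inter> (`) g ` seed_edges)"
    by (intro card_Un_Int) (simp_all add: finite_seed_edges)
  ultimately show ?thesis using card_seed_image[OF f] card_seed_image[OF g] by linarith
qed

text \<open>Pairs of copies are grouped by their agreement set \<open>T\<close>. For given
  \<open>f\<close> there are at most \<open>m ^ (10 - card T)\<close> maps \<open>g\<close>, and the
  loss of common edges bounds the joint probability; relative to the squared mean this leaves one
  summand per \<open>T\<close>. The empty set contributes 1, which cancels the \<open>- 1\<close> of
  the second moment bound.\<close>

lemma prob_no_seed: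
  assumes p: "0 < p" "p \<le> 1" and m: "0 < m" "10 * m \<le> n"
  shows "measure_pmf.prob (random_graph n p) {G. \<forall>f\<in>seed_maps m. \<not> (`) f ` seed_edges \<subseteq> edges G}
    \<le> (\<Sum>T\<in>Pow {..<10} - {{}}. 1 / (real m ^ card T * p ^ card (seed_edges \<inter> Pow T)))"
proof -
  let ?M = "random_graph n p" and ?\<Phi> = "seed_maps m"
  let ?e = "\<lambda>T. card (seed_edges \<inter> Pow T)"
  let ?ag = "\<lambda>f g. {i \<in> {..<10}. f i = g i}"
  define A where "A = (\<lambda>f. {G :: nat graph. (`) f ` seed_edges \<subseteq> edges G})"
  have sub: "(`) f ` seed_edges \<subseteq> nsets {..<n} 2" if "f \<in> ?\<Phi>" for f
  proof clarify
    fix e assume "e \<in> seed_edges"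
    then have "e \<in> nsets {..<10} 2" using seed_edges_sub by blast
    then obtain i j where ij: "e = {i, j}" "i < 10" "j < 10" "i \<noteq> j" by (auto simp: nsets_def card_2_iff)
    have "f i \<noteq> f j" using seed_maps_eq[OF that that] ij by blast
    then show "f ` e \<in> nsets {..<n} 2"
      using ij seed_maps_less[OF that m(2)] by (simp add: doubleton_in_nsets_2)
  qed
  have PA: "measure_pmf.prob ?M (A f) = p ^ 13" if "f \<in> ?\<Phi>" for f
    unfolding A_def using prob_contains[OF _ p(2) sub[OF that]] p card_seed_image[OF that] by simp
  have PAA: "measure_pmf.prob ?M (A f \<inter> A g) \<le> p ^ 26 / p ^ ?e (?ag f g)" if "f \<in> ?\<Phi>" "g \<in> ?\<Phi>" for f g
  proof -
    have "A f \<inter> A g = {G. (`) f ` seed_edges \<union> (`) g ` seed_edges \<subseteq> edges G}"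
      by (auto simp: A_def)
    then have "measure_pmf.prob ?M (A f \<inter> A g) = p ^ card ((`) f ` seed_edges \<union> (`) g ` seed_edges)"
      using prob_contains[of p "(`) f ` seed_edges \<union> (`) g ` seed_edges" n] p sub that by simp
    also have "\<dots> \<le> p ^ (26 - ?e (?ag f g))"
      using card_seed_overlap[OF that] p by (intro power_decreasing) auto
    also have "\<dots> = p ^ 26 / p ^ ?e (?ag f g)"
    proof -
      have "?e (?ag f g) \<le> card seed_edges" by (intro card_mono finite_seed_edges) auto
      then show ?thesis using p card_seed_edges by (simp add: power_diff)
    qed
    finally show ?thesis .
  qed
  define \<mu> where "\<mu> = real m ^ 10 * p ^ 13"
  have \<mu>_sum: "\<mu> = (\<Sum>f\<in>?\<Phi>. measure_pmf.prob ?M (A f))"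
    using PA by (simp add: \<mu>_def card_seed_maps)
  have \<mu>_pos: "0 < \<mu>" using p m by (simp add: \<mu>_def)
  have "(\<Sum>f\<in>?\<Phi>. \<Sum>g\<in>?\<Phi>. measure_pmf.prob ?M (A f \<inter> A g)) \<le> (\<Sum>f\<in>?\<Phi>. \<Sum>g\<in>?\<Phi>. p ^ 26 / p ^ ?e (?ag f g))"
    by (intro sum_mono PAA)
  also have "\<dots> = (\<Sum>f\<in>?\<Phi>. \<Sum>T\<in>Pow {..<10}. real (card {g \<in> ?\<Phi>. ?ag f g = T}) * (p ^ 26 / p ^ ?e T))"
  proof (intro sum.cong refl)
    fix f
    have "(\<Sum>g\<in>?\<Phi>. p ^ 26 / p ^ ?e (?ag f g)) =
        (\<Sum>T\<in>Pow {..<10}. \<Sum>g\<in>{g \<in> ?\<Phi>. ?ag f g = T}. p ^ 26 / p ^ ?e (?ag f g))"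
      by (rule sum.group[symmetric]) (auto simp: finite_seed_maps)
    also have "\<dots> = (\<Sum>T\<in>Pow {..<10}. \<Sum>g\<in>{g \<in> ?\<Phi>. ?ag f g = T}. p ^ 26 / p ^ ?e T)"
      by (intro sum.cong refl) (metis (mono_tags, lifting) mem_Collect_eq)
    finally show "(\<Sum>g\<in>?\<Phi>. p ^ 26 / p ^ ?e (?ag f g)) =
        (\<Sum>T\<in>Pow {..<10}. real (card {g \<in> ?\<Phi>. ?ag f g = T}) * (p ^ 26 / p ^ ?e T))"
      by simp
  qed
  also have "\<dots> \<le> (\<Sum>f\<in>?\<Phi>. \<Sum>T\<in>Pow {..<10}. real m ^ (10 - card T) * (p ^ 26 / p ^ ?e T))"
  proof (intro sum_mono mult_right_mono)
    fix f T assume "f \<in> ?\<Phi>" "T \<in> Pow {..<10::nat}"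
    then have "card {g \<in> ?\<Phi>. ?ag f g = T} \<le> m ^ (10 - card T)"
      by (intro card_seed_maps_agree) auto
    then show "real (card {g \<in> ?\<Phi>. ?ag f g = T}) \<le> real m ^ (10 - card T)"
      unfolding of_nat_power[symmetric] of_nat_le_iff .
  qed (use p in auto)
  also have "\<dots> = (\<Sum>T\<in>Pow {..<10}. real m ^ 10 * (real m ^ (10 - card T) * (p ^ 26 / p ^ ?e T)))"
    by (simp add: card_seed_maps sum_distrib_left)
  also have "\<dots> = (\<Sum>T\<in>Pow {..<10}. \<mu>\<^sup>2 * (1 / (real m ^ card T * p ^ ?e T)))"
  proof (intro sum.cong refl)
    fix T assume "T \<in> Pow {..<10::nat}"
    then have "card T \<le> 10" using card_mono[of "{..<10::nat}" T] by simp
    then have "real m ^ (10 - card T) = real m ^ 10 / real m ^ card T"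
      using m by (simp add: power_diff)
    moreover have "\<mu>\<^sup>2 = real m ^ 10 * real m ^ 10 * p ^ 26"
      by (simp add: \<mu>_def power2_eq_square power_add[symmetric] mult_ac)
    ultimately show "real m ^ 10 * (real m ^ (10 - card T) * (p ^ 26 / p ^ ?e T)) =
        \<mu>\<^sup>2 * (1 / (real m ^ card T * p ^ ?e T))"
      by simp
  qed
  also have "\<dots> = \<mu>\<^sup>2 * (\<Sum>T\<in>Pow {..<10}. 1 / (real m ^ card T * p ^ ?e T))"
    by (simp add: sum_distrib_left)
  finally have "(\<Sum>f\<in>?\<Phi>. \<Sum>g\<in>?\<Phi>. measure_pmf.prob ?M (A f \<inter> A g)) / \<mu>\<^sup>2
      \<le> (\<Sum>T\<in>Pow {..<10}. 1 / (real m ^ card T * p ^ ?e T))"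
    using \<mu>_pos by (simp add: divide_le_eq mult.commute)
  moreover have "(\<Sum>T\<in>Pow {..<10}. 1 / (real m ^ card T * p ^ ?e T)) =
      1 + (\<Sum>T\<in>Pow {..<10} - {{}}. 1 / (real m ^ card T * p ^ ?e T))"
  proof -
    have "seed_edges \<inter> Pow {} = {}" by (auto simp: seed_edges_def)
    then show ?thesis by (subst sum.remove[of _ "{}"]) auto
  qed
  moreover have "{G. \<forall>f\<in>?\<Phi>. \<not> (`) f ` seed_edges \<subseteq> edges G} = {G. \<forall>f\<in>?\<Phi>. G \<notin> A f}"
    by (simp add: A_def)
  moreover have "measure_pmf.prob ?M {G. \<forall>f\<in>?\<Phi>. G \<notin> A f} \<le>
      (\<Sum>f\<in>?\<Phi>. \<Sum>g\<in>?\<Phi>. measure_pmf.prob ?M (A f \<inter> A g)) / \<mu>\<^sup>2 - 1"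
    by (rule second_moment_none[OF finite_set_random_graph finite_seed_maps \<mu>_sum \<mu>_pos])
  ultimately show ?thesis by simp
qed

section \<open>Connectivity and non-bipartiteness\<close>

lemma prob_disconnected:
  assumes p: "0 \<le> p" "p \<le> 1"
  shows "measure_pmf.prob (random_graph n p)
      {G. \<exists>S. S \<noteq> {} \<and> S \<subset> {..<n} \<and> (\<forall>a\<in>S. \<forall>b\<in>{..<n} - S. {a, b} \<notin> edges G)}
    \<le> (1 + exp (- p * real n / 2)) ^ n - 1"
proof -
  define Z where "Z = (\<lambda>S. (\<lambda>(a, b). {a, b}) ` (S \<times> ({..<n} - S)))"
  \<comment> \<open>Of the two sides of a cut the smaller is taken; each of its vertices then has at
    least \<open>n / 2\<close> pairs across the cut.\<close>
  define I where "I = {S \<in> Pow {..<n} - {{}}. 2 * card S \<le> n}"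
  define q where "q = exp (- p * real n / 2)"
  have "measure_pmf.prob (random_graph n p)
      {G. \<exists>S. S \<noteq> {} \<and> S \<subset> {..<n} \<and> (\<forall>a\<in>S. \<forall>b\<in>{..<n} - S. {a, b} \<notin> edges G)}
    \<le> (\<Sum>S\<in>I. measure_pmf.prob (random_graph n p) {G. Z S \<inter> edges G = {}})"
  proof (rule prob_union_bound)
    show "finite I" by (simp add: I_def)
  next
    fix G :: "nat graph"
    assume "G \<in> {G. \<exists>S. S \<noteq> {} \<and> S \<subset> {..<n} \<and> (\<forall>a\<in>S. \<forall>b\<in>{..<n} - S. {a, b} \<notin> edges G)}"
    then obtain S where S: "S \<noteq> {}" "S \<subset> {..<n}" "\<And>a b. a \<in> S \<Longrightarrow> b \<in> {..<n} - S \<Longrightarrow> {a, b} \<notin> edges G"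
      by blast
    have card: "card ({..<n} - S) = n - card S"
      using S(2) by (subst card_Diff_subset) (auto intro: finite_subset)
    show "\<exists>S\<in>I. G \<in> {G. Z S \<inter> edges G = {}}"
    proof (cases "2 * card S \<le> n")
      case True
      then show ?thesis using S by (intro bexI[of _ S]) (auto simp: I_def Z_def)
    next
      case False
      have "{..<n} - ({..<n} - S) = S" using S(2) by blast
      moreover have "{..<n} - S \<in> I" using False S(2) card by (auto simp: I_def)
      moreover have "{b, a} \<notin> edges G" if "a \<in> S" "b \<in> {..<n} - S" for a b
        using S(3)[OF that] by (simp add: insert_commute)
      ultimately show ?thesis by (intro bexI[of _ "{..<n} - S"]) (auto simp: Z_def)
    qed
  qed
  also have "\<dots> \<le> (\<Sum>S\<in>I. q ^ card S)"
  proof (rule sum_mono)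
    fix S assume "S \<in> I"
    then have S: "S \<subseteq> {..<n}" "2 * card S \<le> n" by (auto simp: I_def)
    have fS: "finite S" using S(1) finite_subset by blast
    have "inj_on (\<lambda>(a, b). {a, b}) (S \<times> ({..<n} - S))"
      by (auto simp: inj_on_def doubleton_eq_iff)
    then have "card (Z S) = card S * (n - card S)"
      unfolding Z_def using S(1) fS by (simp add: card_image card_cartesian_product card_Diff_subset)
    then have "real (card (Z S)) = real (card S) * (real n - real (card S))"
      using S(2) by (simp add: of_nat_diff)
    also have "\<dots> \<ge> real (card S) * (real n / 2)"
      using S(2) by (intro mult_left_mono) auto
    finally have "p * (real (card S) * (real n / 2)) \<le> p * real (card (Z S))"
      using p(1) by (intro mult_left_mono) auto
    moreover have "Z S \<subseteq> nsets {..<n} 2" using S(1) by (auto simp: Z_def doubleton_in_nsets_2)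
    ultimately have "measure_pmf.prob (random_graph n p) {G. Z S \<inter> edges G = {}}
        \<le> exp (- (p * (real (card S) * (real n / 2))))"
      using prob_avoids_le[OF p, of "Z S" n] by (smt (verit) exp_le_cancel_iff mult_minus_left)
    also have "\<dots> = q ^ card S"
      unfolding q_def exp_of_nat_mult[symmetric] by (simp add: mult_ac)
    finally show "measure_pmf.prob (random_graph n p) {G. Z S \<inter> edges G = {}} \<le> q ^ card S" .
  qed
  also have "\<dots> \<le> (\<Sum>S\<in>Pow {..<n} - {{}}. q ^ card S)"
    by (intro sum_mono2) (auto simp: I_def q_def)
  also have "\<dots> = (1 + q) ^ n - 1"
    using sum_Pow_power_card[of "{..<n}" q] by (simp add: sum_diff1)
  finally show ?thesis by (simp add: q_def)
qed

lemma prob_bipartite: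
  assumes p: "0 \<le> p" "p \<le> 1"
  shows "measure_pmf.prob (random_graph n p)
      {G. \<exists>S. S \<subseteq> {..<n} \<and> (\<forall>e\<in>edges G. \<not> e \<subseteq> S \<and> \<not> e \<subseteq> {..<n} - S)}
    \<le> 2 ^ n * exp (- p * (real n * (real n - 2) / 4))"
proof -
  define Z where "Z = (\<lambda>S. nsets S 2 \<union> nsets ({..<n} - S) 2)"
  have "measure_pmf.prob (random_graph n p)
      {G. \<exists>S. S \<subseteq> {..<n} \<and> (\<forall>e\<in>edges G. \<not> e \<subseteq> S \<and> \<not> e \<subseteq> {..<n} - S)}
    \<le> (\<Sum>S\<in>Pow {..<n}. measure_pmf.prob (random_graph n p) {G. Z S \<inter> edges G = {}})"
  proof (rule prob_union_bound)
    fix G :: "nat graph"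
    assume "G \<in> {G. \<exists>S. S \<subseteq> {..<n} \<and> (\<forall>e\<in>edges G. \<not> e \<subseteq> S \<and> \<not> e \<subseteq> {..<n} - S)}"
    then obtain S where S: "S \<subseteq> {..<n}" "\<And>e. e \<in> edges G \<Longrightarrow> \<not> e \<subseteq> S \<and> \<not> e \<subseteq> {..<n} - S"
      by blast
    have "Z S \<inter> edges G = {}" using S(2) by (fastforce simp: Z_def nsets_def)
    then show "\<exists>S\<in>Pow {..<n}. G \<in> {G. Z S \<inter> edges G = {}}" using S(1) by blast
  qed simp
  also have "\<dots> \<le> (\<Sum>S\<in>Pow {..<n}. exp (- p * (real n * (real n - 2) / 4)))"
  proof (rule sum_mono)
    fix S assume "S \<in> Pow {..<n}"
    then have S: "S \<subseteq> {..<n}" by auto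
    have fS: "finite S" using S finite_subset by blast
    define s where "s = real (card S)"
    define t where "t = real (card ({..<n} - S))"
    have st: "s + t = real n"
      using S fS card_mono[OF _ S] by (simp add: s_def t_def card_Diff_subset of_nat_diff)
    have two: "real (k choose 2) = real k * (real k - 1) / 2" for k
      by (cases k) (auto simp: choose_two real_of_nat_div field_simps)
    have "nsets S 2 \<inter> nsets ({..<n} - S) 2 = {}"
    proof -
      have False if "e \<in> nsets S 2" "e \<in> nsets ({..<n} - S) 2" for e
      proof -
        have e: "e \<subseteq> S" "e \<subseteq> {..<n} - S" "card e = 2" using that by (simp_all add: nsets_def)
        then have "e = {}" by blast
        then show False using e(3) by simp
      qed
      then show ?thesis by blast
    qed
    then have "card (Z S) = (card S choose 2) + (card ({..<n} - S) choose 2)"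
      unfolding Z_def using fS by (subst card_Un_disjoint) (auto simp: finite_imp_finite_nsets)
    then have "real (card (Z S)) = s * (s - 1) / 2 + t * (t - 1) / 2"
      by (simp add: two s_def t_def)
    \<comment> \<open>By convexity the number of pairs inside the two parts is smallest for equal
      parts.\<close>
    also have "\<dots> \<ge> real n * (real n - 2) / 4"
    proof -
      have "0 \<le> (s - t)\<^sup>2" by simp
      then show ?thesis unfolding st[symmetric] by (simp add: power2_eq_square field_simps)
    qed
    finally have "p * (real n * (real n - 2) / 4) \<le> p * real (card (Z S))"
      using p(1) by (intro mult_left_mono) auto
    moreover have "Z S \<subseteq> nsets {..<n} 2" using S by (auto simp: Z_def nsets_def)
    ultimately show "measure_pmf.prob (random_graph n p) {G. Z S \<inter> edges G = {}}
        \<le> exp (- p * (real n * (real n - 2) / 4))"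
      using prob_avoids_le[OF p, of "Z S" n] by (smt (verit) exp_le_cancel_iff mult_minus_left)
  qed
  also have "\<dots> = 2 ^ n * exp (- p * (real n * (real n - 2) / 4))"
    by (simp add: card_Pow)
  finally show ?thesis .
qed

section \<open>Choice of constants and the two bounds\<close>

lemma prob_not_percolates:
  assumes p: "0 < p" "p \<le> 1" and m: "0 < m" "10 * m \<le> n"
  shows "1 - measure_pmf.prob (random_graph n p) {G. percolates K24 G} \<le>
    (\<Sum>T\<in>Pow {..<10} - {{}}. 1 / (real m ^ card T * p ^ card (seed_edges \<inter> Pow T)))
    + ((1 + exp (- p * real n / 2)) ^ n - 1) + 2 ^ n * exp (- p * (real n * (real n - 2) / 4))"
proof -
  let ?M = "random_graph n p"
  define N where "N = {G. \<forall>f\<in>seed_maps m. \<not> (`) f ` seed_edges \<subseteq> edges G}"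
  define C where "C = {G. \<exists>S. S \<noteq> {} \<and> S \<subset> {..<n} \<and> (\<forall>a\<in>S. \<forall>b\<in>{..<n} - S. {a, b} \<notin> edges G)}"
  define B where "B = {G. \<exists>S. S \<subseteq> {..<n} \<and> (\<forall>e\<in>edges G. \<not> e \<subseteq> S \<and> \<not> e \<subseteq> {..<n} - S)}"
  have "1 - measure_pmf.prob ?M {G. percolates K24 G} = measure_pmf.prob ?M {G. \<not> percolates K24 G}"
    using measure_pmf.prob_compl[of "{G. percolates K24 G}" ?M] by (simp add: Collect_neg_eq Compl_eq_Diff_UNIV)
  also have "\<dots> \<le> (\<Sum>X\<in>{N, C, B}. measure_pmf.prob ?M X)"
  proof (rule prob_union_bound[where A = id, unfolded id_apply])
    fix G assume G: "G \<in> set_pmf ?M" "G \<in> {G. \<not> percolates K24 G}"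
    note wf = set_random_graph[OF G(1)]
    show "\<exists>X\<in>{N, C, B}. G \<in> X"
    proof (rule ccontr)
      assume no: "\<not> (\<exists>X\<in>{N, C, B}. G \<in> X)"
      then obtain f where f: "f \<in> seed_maps m" "(`) f ` seed_edges \<subseteq> edges G"
        by (auto simp: N_def)
      have "percolates K24 G"
      proof (rule seed_percolates)
        show "edges G \<subseteq> nsets (verts G) 2" using wf by simp
        show "\<exists>a\<in>S. \<exists>b\<in>verts G - S. {a, b} \<in> edges G" if "S \<noteq> {}" "S \<subset> verts G" for S
        proof (rule ccontr)
          assume "\<not> ?thesis"
          then have "G \<in> C" unfolding C_def using that wf by (intro CollectI exI[of _ S]) auto
          then show False using no by simp
        qed
        show "\<exists>e\<in>edges G. e \<subseteq> S \<or> e \<subseteq> verts G - S" if "S \<subseteq> verts G" for S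
        proof (rule ccontr)
          assume "\<not> ?thesis"
          then have "G \<in> B" unfolding B_def using that wf by (intro CollectI exI[of _ S]) auto
          then show False using no by simp
        qed
        show "inj_on f {..<10}" by (rule seed_maps_inj[OF f(1)])
        show "f ` e \<in> edges G" if "e \<in> seed_edges" for e using f(2) that by blast
      qed
      then show False using G(2) by simp
    qed
  qed simp
  also have "\<dots> \<le> measure_pmf.prob ?M N + measure_pmf.prob ?M C + measure_pmf.prob ?M B"
    by (simp add: sum.insert_if)
  finally show ?thesis
    using prob_no_seed[OF p m] prob_disconnected[of p n] prob_bipartite[of p n] p
    unfolding N_def C_def B_def by linarith
qed

text \<open>For the full set the powers of \<open>n\<close> cancel, and the factor 20 in
  \<open>p\<close> outweighs the loss in \<open>m \<ge> n / 20\<close>: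
  \<open>20 ^ 13 / 20 ^ 10 = 8000\<close>. For a proper subset, weight at least 1 leaves a factor
  \<open>n powr (1 / 13)\<close>, and the powers of 20 cost at most \<open>20 ^ 10\<close>.\<close>

lemma seed_term_le:
  fixes n m :: nat
  assumes n: "1 \<le> n" "real n \<le> 20 * real m" and p: "p = 20 * real n powr (- 10 / 13)"
    and T: "T \<subseteq> {..<10}" "T \<noteq> {}"
  shows "1 / (real m ^ card T * p ^ card (seed_edges \<inter> Pow T)) \<le> 20 ^ 10 * real n powr (- 1 / 13) + 
    (if T = {..<10} then 1 / 8000 else 0)"
proof -
  define t where "t = card T"
  define e where "e = card (seed_edges \<inter> Pow T)"
  have n0: "0 < real n" using n by simp
  have lower: "(real n / 20) ^ t * p ^ e \<le> real m ^ t * p ^ e"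
    using n p by (intro mult_right_mono power_mono) auto
  have pe: "p ^ e = 20 ^ e * real n powr (- 10 / 13 * real e)"
    unfolding p using n0 by (simp add: power_mult_distrib powr_powr flip: powr_realpow)
  have nt: "(real n / 20) ^ t = real n powr real t / 20 ^ t"
    using n0 by (simp add: power_divide powr_realpow)
  have eq: "(real n / 20) ^ t * p ^ e = 20 ^ e / 20 ^ t * real n powr (real t - 10 / 13 * real e)"
    unfolding pe nt by (simp add: powr_diff[symmetric] powr_add[symmetric] field_simps flip: powr_add)
  have t10: "t \<le> 10" using T card_mono[of "{..<10::nat}" T] by (simp add: t_def)
  show ?thesis
  proof (cases "T = {..<10}")
    case True
    have "t = 10" "e = 13"
      using True card_seed_edges seed_edges_sub by (auto simp: t_def e_def Int_absorb2 nsets_def subset_iff Pow_def)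
    then have "(real n / 20) ^ t * p ^ e = 8000" unfolding eq using n0 by simp
    then have "8000 \<le> real m ^ t * p ^ e" using lower by simp
    then have "1 / (real m ^ t * p ^ e) \<le> 1 / 8000" by (intro divide_left_mono) auto
    moreover have "0 \<le> 20 ^ 10 * real n powr (- 1 / 13)" by simp
    ultimately show ?thesis unfolding if_P[OF True] t_def e_def by linarith
  next
    case False
    have te: "10 * e + 1 \<le> 13 * t"
      using seed_strictly_balanced[OF T False] by (simp add: t_def e_def)
    then have "real (10 * e + 1) \<le> real (13 * t)" by (rule of_nat_mono)
    then have "1 / 13 \<le> real t - 10 / 13 * real e" by simp
    then have "real n powr (1 / 13) \<le> real n powr (real t - 10 / 13 * real e)"
      using n by (intro powr_mono) auto
    moreover have "1 / 20 ^ 10 \<le> (20 ^ e / 20 ^ t :: real)"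
    proof -
      have "(20::real) ^ t \<le> 20 ^ 10" using t10 by (intro power_increasing) auto
      then show ?thesis by (intro frac_le) simp_all
    qed
    ultimately have "1 / 20 ^ 10 * real n powr (1 / 13) \<le> real m ^ t * p ^ e"
      using lower unfolding eq by (smt (verit) mult_mono powr_ge_zero divide_nonneg_nonneg zero_le_power)
    moreover have "0 < 1 / 20 ^ 10 * real n powr (1 / 13)" using n0 by simp
    ultimately have "1 / (real m ^ t * p ^ e) \<le> 1 / (1 / 20 ^ 10 * real n powr (1 / 13))"
      by (intro frac_le) (assumption | simp)+
    also have "\<dots> = 20 ^ 10 * real n powr (- 1 / 13)"
      using n0 by (simp add: powr_minus field_simps)
    finally show ?thesis using False unfolding t_def e_def by simp
  qed
qed

text \<open>There are \<open>1023 = 2 ^ 10 - 1\<close> nonempty sets \<open>T\<close>, and only the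
  full one contributes something that does not vanish as \<open>n\<close> grows.\<close>

lemma seed_sum_le:
  fixes n m :: nat
  assumes "1 \<le> n" "real n \<le> 20 * real m" and "p = 20 * real n powr (- 10 / 13)"
  shows "(\<Sum>T\<in>Pow {..<10} - {{}}. 1 / (real m ^ card T * p ^ card (seed_edges \<inter> Pow T)))
    \<le> 1023 * 20 ^ 10 * real n powr (- 1 / 13) + 1 / 8000"
proof -
  have "(\<Sum>T\<in>Pow {..<10} - {{}}. 1 / (real m ^ card T * p ^ card (seed_edges \<inter> Pow T)))
    \<le> (\<Sum>T\<in>Pow {..<10} - {{}}. 20 ^ 10 * real n powr (- 1 / 13) + 
      (if T = {..<10::nat} then 1 / 8000 else 0))"
    by (intro sum_mono seed_term_le assms) auto
  also have "\<dots> = 1023 * (20 ^ 10 * real n powr (- 1 / 13)) + 1 / 8000"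
    by (simp add: sum.distrib card_Pow lessThan_empty_iff)
  finally show ?thesis by simp
qed

lemma eventually_percolates:
  "eventually (\<lambda>n. 20 * real n powr (- 10 / 13) \<le> 1 \<and>
     measure_pmf.prob (random_graph n (20 * real n powr (- 10 / 13))) {G. percolates K24 G} \<ge> 1 / 2) sequentially"
proof -
  let ?p = "\<lambda>n. 20 * real n powr (- 10 / 13)"
  have 1: "eventually (\<lambda>n. ?p n \<le> 1) sequentially" by real_asymp
  have 2: "eventually (\<lambda>n. 1023 * 20 ^ 10 * real n powr (- 1 / 13) \<le> 1 / 8) sequentially" by real_asymp
  have 3: "eventually (\<lambda>n. (1 + exp (- ?p n * real n / 2)) ^ n - 1 \<le> 1 / 8) sequentially" by real_asymp
  have 4: "eventually (\<lambda>n. 2 ^ n * exp (- ?p n * (real n * (real n - 2) / 4)) \<le> 1 / 8) sequentially"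
    by real_asymp
  from 1 2 3 4 eventually_ge_at_top[of 20] show ?thesis
  proof eventually_elim
    case (elim n)
    \<comment> \<open>Ten intervals of length \<open>m\<close> fit into the vertex set, and rounding
      down loses at most a factor 2, whence \<open>n \<le> 20 * m\<close>.\<close>
    define m where "m = n div 10"
    have m: "0 < m" "10 * m \<le> n" "n \<le> 20 * m" using elim(5) by (auto simp: m_def)
    have "real n \<le> 20 * real m" using m(3) by linarith
    \<comment> \<open>The failure probabilities add up to at most
      \<open>3 / 8 + 1 / 8000\<close>.\<close>
    then have "1 - measure_pmf.prob (random_graph n (?p n)) {G. percolates K24 G} \<le> 1 / 2"
      using prob_not_percolates[of "?p n", OF _ elim(1) m(1,2)] seed_sum_le[of n m, OF _ _ refl] elim
      by simp
    then show ?case using elim(1) by simp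
  qed
qed

theorem theorem2p8:
  shows "(\<lambda>n. critical_prob n (complete_bipartite 2 4)) \<in> \<Theta>(\<lambda>n. real n powr (- 10 / 13))"
proof -
  let ?S = "\<lambda>n. {p \<in> {0..1}. measure_pmf.prob (random_graph n p) {G. percolates K24 G} \<ge> 1 / 2}"
  obtain b :: nat where b: "b = 100 choose 2" by blast
  \<comment> \<open>The factor 7 makes the first moment bound \<open>3 * 2 ^ b * c\<close> equal to
    \<open>3 / 7\<close>, just below one half.\<close>
  define c where "c = (1::real) / (7 * 2 ^ b)"
  have c: "0 < c" "c \<le> 1" "3 * 2 ^ b * c < 1 / 2"
  proof -
    have "(1::real) \<le> 2 ^ b" by simp
    then have "1 \<le> 7 * (2::real) ^ b" by linarith
    then show "0 < c" "c \<le> 1" "3 * 2 ^ b * c < 1 / 2" by (simp_all add: c_def)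
  qed
  have bdd: "bdd_below (?S n)" for n by (intro bdd_belowI[of _ 0]) auto
  \<comment> \<open>The first moment bound applies to each \<open>p\<close> below the threshold
    separately, so the threshold bounds the whole set from below.\<close>
  have lower: "c * real n powr (- 10 / 13) \<le> p" if "5 \<le> n" "p \<in> ?S n" for n p
  proof (rule ccontr)
    assume "\<not> c * real n powr (- 10 / 13) \<le> p"
    then have "measure_pmf.prob (random_graph n p) {G. percolates K24 G} \<le> 3 * 2 ^ b * c"
      using that by (intro prob_percolates_small c b) auto
    then show False using that(2) c(3) by simp
  qed
  show ?thesis
  proof (rule bigthetaI')
    show "0 < c" "(0::real) < 20" using c by simp_all
    show "\<forall>\<^sub>F n in sequentially. c * norm (real n powr (- 10 / 13)) \<le> norm (critical_prob n K24) \<and>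
        norm (critical_prob n K24) \<le> 20 * norm (real n powr (- 10 / 13))"
      using eventually_percolates eventually_ge_at_top[of 5]
    proof eventually_elim
      case (elim n)
      let ?p = "20 * real n powr (- 10 / 13)"
      \<comment> \<open>This membership yields the upper bound and also the nonemptiness without
        which a lower bound of the set says nothing about its \<open>Inf\<close>.\<close>
      have in_S: "?p \<in> ?S n" using elim by simp
      have "critical_prob n K24 \<le> ?p"
        unfolding critical_prob_def by (rule cInf_lower[OF in_S bdd])
      moreover have "c * real n powr (- 10 / 13) \<le> critical_prob n K24"
        unfolding critical_prob_def using in_S lower[OF elim(2)] by (intro cInf_greatest) auto
      moreover have "0 \<le> c * real n powr (- 10 / 13)" using c by simp
      ultimately show ?case by simp
    qed
  qed
qed

end
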